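(* Let $X$ be a closed manifold, $P\to X$ a principal $K$-bundle, $G=\mathrm{ad}\,P$ its adjoint bundle, $\psi\in\Gamma(G)$, $\lambda\in\mathbb{R}$, and let $B_{p,q}=\Omega^p(X)\otimes\mathrm{Sym}^q(G)$, $S^\bullet=\bigoplus_{p+q=\bullet}B_{p,q}$, with total differential $$D_{\lambda,\psi}=d\otimes 1+(-1)^{\deg_{\mathrm{dR}}}\lambda\,(1\otimes\iota^{\wedge}_\psi).$$ Let $U$ and $J_\alpha$ ($\alpha>0$) be the automorphisms of $S^\bullet$ given by $U|_{B_{p,q}}=(-1)^q\,\mathrm{id}$ and $J_\alpha|_{B_{p,q}}=\alpha^q\,\mathrm{id}$. Then $$U D_{\lambda,\psi}U^{-1}=D_{-\lambda,\psi}=D_{\lambda,-\psi},\qquad J_\alpha D_{\lambda,\psi}J_\alpha^{-1}=D_{\alpha\lambda,\psi}.$$ In particular, for all $\lambda>0$, the complex $(S^\bullet,D_{\lambda,\psi})$ is chain homotopy equivalent to $(S^\bullet,D_{1,\psi})$ and to $(S^\bullet,D_{1,-\psi})$.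
   Context: $K$ is a Lie group and $G=\mathrm{ad}\,P$ is the bundle associated to $P$ by the adjoint representation. For each $\psi\in\Gamma(G)$, $\iota^{\wedge}_\psi:\mathrm{Sym}^q(G)\to\mathrm{Sym}^{q+1}(G)$ ($q\ge 0$) is a fiberwise (zero-order) derivation raising the symmetric degree by one, depending linearly on $\psi$ (so $\iota^\wedge_{-\psi}=-\iota^\wedge_\psi$), satisfying $(\iota^{\wedge}_\psi)^2=0$ and commuting with the de Rham differential in the sense $[d\otimes 1,1\otimes\iota^\wedge_\psi]=0$. The sign $(-1)^{\deg_{\mathrm{dR}}}$ equals $(-1)^p$ on $B_{p,q}$. Thus $D_{\lambda,\psi}$ has total degree $+1$ and $D_{\lambda,\psi}^2=0$. *)

theory Defs
  imports "HOL-Analysis.Analysis" "HOL-Algebra.Group" "HOL-Library.Function_Algebras"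
    "HOL-Library.Multiset"
begin

section \<open>Linear algebra in function spaces\<close>

text \<open>Sums and products of functions are pointwise, from the library theory of function algebras;
  this adds pointwise scaling. All vector spaces below are subspaces of such function types.\<close>

instantiation "fun" :: (type, real_vector) real_vector
begin

definition scaleR_fun :: "real \<Rightarrow> ('a \<Rightarrow> 'b) \<Rightarrow> 'a \<Rightarrow> 'b" where
  "scaleR_fun c f = (\<lambda>x. c *\<^sub>R f x)"

instance
  by standard (auto simp: scaleR_fun_def plus_fun_def fun_eq_iff algebra_simps)

end

definition linear_map_on :: "'a::real_vector set \<Rightarrow> 'b::real_vector set \<Rightarrow> ('a \<Rightarrow> 'b) \<Rightarrow> bool" where
  "linear_map_on V W f \<longleftrightarrow> f ` V \<subseteq> W \<and>
     (\<forall>a\<in>V. \<forall>b\<in>V. f (a + b) = f a + f b) \<and> (\<forall>c. \<forall>a\<in>V. f (c *\<^sub>R a) = c *\<^sub>R f a)"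

subsection \<open>Tensor products over the reals\<close>

definition bilinear_form_on ::
  "'a::real_vector set \<Rightarrow> 'b::real_vector set \<Rightarrow> ('a \<Rightarrow> 'b \<Rightarrow> real) \<Rightarrow> bool" where
  "bilinear_form_on V W \<beta> \<longleftrightarrow>
     (\<forall>w\<in>W. linear_map_on V UNIV (\<lambda>v. \<beta> v w)) \<and> (\<forall>v\<in>V. linear_map_on W UNIV (\<beta> v))"

text \<open>The algebraic tensor product is realised as in R. Ryan's textbook on tensor products of Banach
  spaces: \<open>v \<otimes> w\<close> is the evaluation functional \<open>\<beta> \<mapsto> \<beta>(v, w)\<close> on bilinear forms on
  \<open>V \<times> W\<close>, and \<open>V \<otimes> W\<close> is the span of these functionals.\<close>

definition pure_tensor :: "'a::real_vector set \<Rightarrow> 'b::real_vector set \<Rightarrow> 'a \<Rightarrow> 'b \<Rightarrow>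
    ('a \<Rightarrow> 'b \<Rightarrow> real) \<Rightarrow> real" where
  "pure_tensor V W v w = (\<lambda>\<beta>. if bilinear_form_on V W \<beta> then \<beta> v w else 0)"

definition tensor_product :: "'a::real_vector set \<Rightarrow> 'b::real_vector set \<Rightarrow>
    (('a \<Rightarrow> 'b \<Rightarrow> real) \<Rightarrow> real) set" where
  "tensor_product V W = span {pure_tensor V W v w | v w. v \<in> V \<and> w \<in> W}"

text \<open>For linear \<open>f : V \<rightarrow> V'\<close> and \<open>g : W \<rightarrow> W'\<close> this is \<open>f \<otimes> g\<close>; the two set arguments
  are the targets \<open>V'\<close> and \<open>W'\<close>. It sends \<open>v \<otimes> w\<close> to \<open>f v \<otimes> g w\<close>.\<close>

definition tensor_map :: "'c::real_vector set \<Rightarrow> 'd::real_vector set \<Rightarrow>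
    ('a::real_vector \<Rightarrow> 'c) \<Rightarrow> ('b::real_vector \<Rightarrow> 'd) \<Rightarrow>
    (('a \<Rightarrow> 'b \<Rightarrow> real) \<Rightarrow> real) \<Rightarrow> (('c \<Rightarrow> 'd \<Rightarrow> real) \<Rightarrow> real)" where
  "tensor_map V' W' f g T =
     (\<lambda>\<beta>. if bilinear_form_on V' W' \<beta> then T (\<lambda>v w. \<beta> (f v) (g w)) else 0)"

subsection \<open>Symmetric powers\<close>

definition symmetric_form_on :: "'a::real_vector set \<Rightarrow> nat \<Rightarrow> ('a list \<Rightarrow> real) \<Rightarrow> bool" where
  "symmetric_form_on V q \<beta> \<longleftrightarrow>
     (\<forall>us\<in>lists V. \<forall>vs\<in>lists V. length us + length vs + 1 = q \<longrightarrow>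
        linear_map_on V UNIV (\<lambda>v. \<beta> (us @ v # vs))) \<and>
     (\<forall>us\<in>lists V. \<forall>vs\<in>lists V. length us = q \<and> mset us = mset vs \<longrightarrow> \<beta> us = \<beta> vs)"

text \<open>In the same way, the symmetric product \<open>v\<^sub>1 \<cdots> v\<^sub>q\<close> is the evaluation functional
  \<open>\<beta> \<mapsto> \<beta>(v\<^sub>1, \<dots>, v\<^sub>q)\<close> on symmetric \<open>q\<close>-linear forms, and \<open>Sym\<^sup>q V\<close> is the span
  of these functionals.\<close>

definition symmetric_product :: "'a::real_vector set \<Rightarrow> 'a list \<Rightarrow> ('a list \<Rightarrow> real) \<Rightarrow> real" where
  "symmetric_product V vs = (\<lambda>\<beta>. if symmetric_form_on V (length vs) \<beta> then \<beta> vs else 0)"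

definition Sym :: "'a::real_vector set \<Rightarrow> nat \<Rightarrow> (('a list \<Rightarrow> real) \<Rightarrow> real) set" where
  "Sym V q = span {symmetric_product V vs | vs. vs \<in> lists V \<and> length vs = q}"

text \<open>The multiplication \<open>Sym\<^sup>q V \<times> Sym\<^sup>r V \<rightarrow> Sym\<^sup>q\<^sup>+\<^sup>r V\<close>; it sends
  \<open>(u\<^sub>1 \<cdots> u\<^sub>q, v\<^sub>1 \<cdots> v\<^sub>r)\<close> to \<open>u\<^sub>1 \<cdots> u\<^sub>q v\<^sub>1 \<cdots> v\<^sub>r\<close>.\<close>

definition Sym_mult :: "'a::real_vector set \<Rightarrow> nat \<Rightarrow> nat \<Rightarrow> (('a list \<Rightarrow> real) \<Rightarrow> real) \<Rightarrow>
    (('a list \<Rightarrow> real) \<Rightarrow> real) \<Rightarrow> (('a list \<Rightarrow> real) \<Rightarrow> real)" where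
  "Sym_mult V q r s t =
     (\<lambda>\<beta>. if symmetric_form_on V (q + r) \<beta> then s (\<lambda>us. t (\<lambda>vs. \<beta> (us @ vs))) else 0)"

section \<open>Smooth manifolds\<close>

definition partial_deriv :: "nat \<Rightarrow> ((nat \<Rightarrow> real) \<Rightarrow> real) \<Rightarrow> (nat \<Rightarrow> real) \<Rightarrow> real" where
  "partial_deriv i f v = deriv (\<lambda>t. f (v(i := t))) (v i)"

text \<open>Smoothness on an open subset of \<open>Euclidean_space n\<close>: all iterated partial derivatives exist
  and are continuous.\<close>

definition C_infinity_on :: "nat \<Rightarrow> (nat \<Rightarrow> real) set \<Rightarrow> ((nat \<Rightarrow> real) \<Rightarrow> real) \<Rightarrow> bool" where
  "C_infinity_on n W f \<longleftrightarrow> (\<forall>is\<in>lists {..<n}.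
     continuous_map (subtopology (Euclidean_space n) W) euclideanreal (fold partial_deriv is f) \<and>
     (\<forall>i<n. \<forall>v\<in>W. (\<lambda>t. fold partial_deriv is f (v(i := t))) differentiable (at (v i))))"

record 'a manifold =
  mdim :: nat
  mtop :: "'a topology"
  matlas :: "('a set \<times> ('a \<Rightarrow> nat \<Rightarrow> real)) set"

abbreviation points :: "'a manifold \<Rightarrow> 'a set" where
  "points M \<equiv> topspace (mtop M)"

definition smooth_manifold :: "'a manifold \<Rightarrow> bool" where
  "smooth_manifold M \<longleftrightarrow>
     Hausdorff_space (mtop M) \<and> second_countable (mtop M) \<and>
     (\<Union>(U, \<phi>)\<in>matlas M. U) = points M \<and>
     (\<forall>(U, \<phi>)\<in>matlas M. openin (mtop M) U \<and> openin (Euclidean_space (mdim M)) (\<phi> ` U) \<and>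
        homeomorphic_map (subtopology (mtop M) U)
          (subtopology (Euclidean_space (mdim M)) (\<phi> ` U)) \<phi>) \<and>
     (\<forall>(U, \<phi>)\<in>matlas M. \<forall>(V, \<theta>)\<in>matlas M. \<forall>j<mdim M.
        C_infinity_on (mdim M) (\<phi> ` (U \<inter> V)) (\<lambda>v. \<theta> (inv_into U \<phi> v) j))"

text \<open>Charts take values in Euclidean space, so manifolds have no boundary.\<close>

definition closed_manifold :: "'a manifold \<Rightarrow> bool" where
  "closed_manifold M \<longleftrightarrow> smooth_manifold M \<and> compact_space (mtop M)"

text \<open>Elements of \<open>C\<^sup>\<infinity>(M)\<close> are extended by zero to the ambient type, so that equality of
  functions on the manifold is equality in the logic. The same convention is used for all sections,
  operators and forms below.\<close>

definition smooth_functions :: "'a manifold \<Rightarrow> ('a \<Rightarrow> real) set" where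
  "smooth_functions M = {f. (\<forall>x. x \<notin> points M \<longrightarrow> f x = 0) \<and>
     (\<forall>(U, \<phi>)\<in>matlas M. C_infinity_on (mdim M) (\<phi> ` U) (\<lambda>v. f (inv_into U \<phi> v)))}"

definition smooth_map :: "'a manifold \<Rightarrow> 'b manifold \<Rightarrow> ('a \<Rightarrow> 'b) \<Rightarrow> bool" where
  "smooth_map M N f \<longleftrightarrow> continuous_map (mtop M) (mtop N) f \<and>
     (\<forall>(U, \<phi>)\<in>matlas M. \<forall>(V, \<theta>)\<in>matlas N. \<forall>j<mdim N.
        C_infinity_on (mdim M) (\<phi> ` {x \<in> U. f x \<in> V}) (\<lambda>v. \<theta> (f (inv_into U \<phi> v)) j))"

definition diffeomorphism :: "'a manifold \<Rightarrow> 'b manifold \<Rightarrow> ('a \<Rightarrow> 'b) \<Rightarrow> bool" where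
  "diffeomorphism M N f \<longleftrightarrow> smooth_map M N f \<and> (\<exists>g. smooth_map N M g \<and>
     (\<forall>x\<in>points M. g (f x) = x) \<and> (\<forall>y\<in>points N. f (g y) = y))"

definition open_submanifold :: "'a manifold \<Rightarrow> 'a set \<Rightarrow> 'a manifold" where
  "open_submanifold M U = \<lparr>mdim = mdim M, mtop = subtopology (mtop M) U,
     matlas = (\<lambda>(V, \<phi>). (V \<inter> U, \<phi>)) ` matlas M\<rparr>"

definition prod_manifold :: "'a manifold \<Rightarrow> 'b manifold \<Rightarrow> ('a \<times> 'b) manifold" where
  "prod_manifold M N = \<lparr>mdim = mdim M + mdim N, mtop = prod_topology (mtop M) (mtop N),
     matlas = {(U \<times> V, \<lambda>(x, y) i. if i < mdim M then \<phi> x i else \<theta> y (i - mdim M)) |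
       U \<phi> V \<theta>. (U, \<phi>) \<in> matlas M \<and> (V, \<theta>) \<in> matlas N}\<rparr>"

section \<open>Differential forms\<close>

text \<open>Vector fields are the derivations of the algebra \<open>C\<^sup>\<infinity>(M)\<close>, differential \<open>p\<close>-forms are
  the alternating \<open>C\<^sup>\<infinity>(M)\<close>-multilinear maps on \<open>p\<close>-tuples of vector fields, and the exterior
  derivative is given by its invariant formula (as in Helgason's textbook, without the
  normalisation factor \<open>1/(p+1)\<close>).\<close>

type_synonym 'x vector_field = "('x \<Rightarrow> real) \<Rightarrow> 'x \<Rightarrow> real"
type_synonym 'x diff_form = "'x vector_field list \<Rightarrow> 'x \<Rightarrow> real"

definition vector_fields :: "'x manifold \<Rightarrow> 'x vector_field set" where
  "vector_fields M = {Y. linear_map_on (smooth_functions M) (smooth_functions M) Y \<and>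
     (\<forall>f\<in>smooth_functions M. \<forall>g\<in>smooth_functions M. Y (f * g) = Y f * g + f * Y g) \<and>
     (\<forall>f. f \<notin> smooth_functions M \<longrightarrow> Y f = 0)}"

definition lie_bracket :: "'x vector_field \<Rightarrow> 'x vector_field \<Rightarrow> 'x vector_field" where
  "lie_bracket Y Z = (\<lambda>f. Y (Z f) - Z (Y f))"

definition forms :: "'x manifold \<Rightarrow> nat \<Rightarrow> 'x diff_form set" where
  "forms M p = {\<omega>.
     (\<forall>Ys. Ys \<in> lists (vector_fields M) \<and> length Ys = p \<longrightarrow> \<omega> Ys \<in> smooth_functions M) \<and>
     (\<forall>Ys. \<not> (Ys \<in> lists (vector_fields M) \<and> length Ys = p) \<longrightarrow> \<omega> Ys = 0) \<and>
     (\<forall>Ys\<in>lists (vector_fields M). \<forall>Zs\<in>lists (vector_fields M).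
        length Ys + length Zs + 1 = p \<longrightarrow>
        (\<forall>f\<in>smooth_functions M. \<forall>V\<in>vector_fields M. \<forall>W\<in>vector_fields M.
           \<omega> (Ys @ ((\<lambda>h. f * V h) + W) # Zs) = f * \<omega> (Ys @ V # Zs) + \<omega> (Ys @ W # Zs))) \<and>
     (\<forall>Ys V Zs Ws. \<omega> (Ys @ V # Zs @ V # Ws) = 0)}"

definition omit :: "nat \<Rightarrow> 'a list \<Rightarrow> 'a list" where
  "omit i xs = take i xs @ drop (Suc i) xs"

definition ext_deriv :: "'x manifold \<Rightarrow> nat \<Rightarrow> 'x diff_form \<Rightarrow> 'x diff_form" where
  "ext_deriv M p \<omega> = (\<lambda>Ys. if Ys \<in> lists (vector_fields M) \<and> length Ys = Suc p then
     (\<Sum>i\<le>p. (- 1) ^ i *\<^sub>R (Ys ! i) (\<omega> (omit i Ys))) +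
     (\<Sum>j\<le>p. \<Sum>i<j. (- 1) ^ (i + j) *\<^sub>R
        \<omega> (lie_bracket (Ys ! i) (Ys ! j) # omit i (omit j Ys)))
     else 0)"

section \<open>Lie groups and principal bundles\<close>

definition lie_group :: "'k monoid \<Rightarrow> 'k manifold \<Rightarrow> bool" where
  "lie_group K KM \<longleftrightarrow> group K \<and> smooth_manifold KM \<and> points KM = carrier K \<and>
     smooth_map (prod_manifold KM KM) KM (\<lambda>(g, h). g \<otimes>\<^bsub>K\<^esub> h) \<and> smooth_map KM KM (\<lambda>g. inv\<^bsub>K\<^esub> g)"

text \<open>The Lie algebra as the tangent space at the identity, consisting of point derivations.\<close>

definition lie_algebra :: "'k monoid \<Rightarrow> 'k manifold \<Rightarrow> (('k \<Rightarrow> real) \<Rightarrow> real) set" where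
  "lie_algebra K KM = {\<xi>. linear_map_on (smooth_functions KM) UNIV \<xi> \<and>
     (\<forall>f\<in>smooth_functions KM. \<forall>g\<in>smooth_functions KM.
        \<xi> (f * g) = \<xi> f * g \<one>\<^bsub>K\<^esub> + f \<one>\<^bsub>K\<^esub> * \<xi> g) \<and>
     (\<forall>f. f \<notin> smooth_functions KM \<longrightarrow> \<xi> f = 0)}"

text \<open>The differential at the identity of the conjugation \<open>h \<mapsto> k h k\<inverse>\<close>.\<close>

definition Ad :: "'k monoid \<Rightarrow> 'k manifold \<Rightarrow> 'k \<Rightarrow>
    (('k \<Rightarrow> real) \<Rightarrow> real) \<Rightarrow> (('k \<Rightarrow> real) \<Rightarrow> real)" where
  "Ad K KM k \<xi> = (\<lambda>f. if f \<in> smooth_functions KM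
     then \<xi> (\<lambda>h. if h \<in> carrier K then f (k \<otimes>\<^bsub>K\<^esub> h \<otimes>\<^bsub>K\<^esub> inv\<^bsub>K\<^esub> k) else 0) else 0)"

record ('x, 'k, 'p) bundle_data =
  base :: "'x manifold"
  str_group :: "'k monoid"
  str_mfd :: "'k manifold"
  total :: "'p manifold"
  proj :: "'p \<Rightarrow> 'x"
  act :: "'p \<Rightarrow> 'k \<Rightarrow> 'p"

definition principal_bundle :: "('x, 'k, 'p) bundle_data \<Rightarrow> bool" where
  "principal_bundle P \<longleftrightarrow>
     smooth_manifold (base P) \<and> lie_group (str_group P) (str_mfd P) \<and> smooth_manifold (total P) \<and>
     smooth_map (total P) (base P) (proj P) \<and>
     smooth_map (prod_manifold (total P) (str_mfd P)) (total P) (\<lambda>(u, k). act P u k) \<and>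
     (\<forall>u\<in>points (total P). act P u \<one>\<^bsub>str_group P\<^esub> = u \<and>
        (\<forall>k\<in>carrier (str_group P). proj P (act P u k) = proj P u \<and>
           (\<forall>l\<in>carrier (str_group P). act P (act P u k) l = act P u (k \<otimes>\<^bsub>str_group P\<^esub> l)))) \<and>
     (\<forall>x\<in>points (base P). \<exists>U \<Phi>. openin (mtop (base P)) U \<and> x \<in> U \<and>
        diffeomorphism (open_submanifold (total P) {u \<in> points (total P). proj P u \<in> U})
          (prod_manifold (open_submanifold (base P) U) (str_mfd P)) \<Phi> \<and>
        (\<forall>u\<in>points (total P). proj P u \<in> U \<longrightarrow> fst (\<Phi> u) = proj P u \<and>
           (\<forall>k\<in>carrier (str_group P).
              \<Phi> (act P u k) = (fst (\<Phi> u), snd (\<Phi> u) \<otimes>\<^bsub>str_group P\<^esub> k))))"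

definition local_section :: "('x, 'k, 'p) bundle_data \<Rightarrow> 'x set \<Rightarrow> ('x \<Rightarrow> 'p) \<Rightarrow> bool" where
  "local_section P U \<sigma> \<longleftrightarrow> openin (mtop (base P)) U \<and>
     smooth_map (open_submanifold (base P) U) (total P) \<sigma> \<and> (\<forall>x\<in>U. proj P (\<sigma> x) = x)"

section \<open>The adjoint bundle and its symmetric powers\<close>

abbreviation lie_alg :: "('x, 'k, 'p) bundle_data \<Rightarrow> (('k \<Rightarrow> real) \<Rightarrow> real) set" where
  "lie_alg P \<equiv> lie_algebra (str_group P) (str_mfd P)"

type_synonym ('k, 'p) adjoint_vec = "'p \<Rightarrow> ('k \<Rightarrow> real) \<Rightarrow> real"
type_synonym ('k, 'p) adjoint_sym = "(('k, 'p) adjoint_vec list \<Rightarrow> real) \<Rightarrow> real"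

text \<open>A point of \<open>ad P\<close> over \<open>x\<close> is a class
  \<open>[u, \<xi>] = {(u k, Ad(k\<inverse>) \<xi>) | k}\<close> of pairs in \<open>P\<^sub>x \<times> Lie(K)\<close>. Such a class is the graph of an
  equivariant function on \<open>P\<^sub>x\<close>, and it is represented by this function.\<close>

definition ad_fibre :: "('x, 'k, 'p) bundle_data \<Rightarrow> 'x \<Rightarrow> ('k, 'p) adjoint_vec set" where
  "ad_fibre P x = {a.
     (\<forall>u. u \<in> points (total P) \<and> proj P u = x \<longrightarrow> a u \<in> lie_alg P \<and>
        (\<forall>k\<in>carrier (str_group P).
           a (act P u k) = Ad (str_group P) (str_mfd P) (inv\<^bsub>str_group P\<^esub> k) (a u))) \<and>
     (\<forall>u. \<not> (u \<in> points (total P) \<and> proj P u = x) \<longrightarrow> a u = 0)}"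

text \<open>A local section \<open>\<sigma>\<close> of \<open>P\<close> trivialises \<open>ad P\<close> by \<open>a \<mapsto> a (\<sigma> x)\<close> and hence also
  \<open>Sym\<^sup>q (ad P)\<close>. A section of these bundles is smooth if its coordinates in all such trivialisations
  are smooth functions. The coordinates on \<open>Sym\<^sup>q Lie(K)\<close> are the symmetric forms.\<close>

definition ad_sections :: "('x, 'k, 'p) bundle_data \<Rightarrow> ('x \<Rightarrow> ('k, 'p) adjoint_vec) set" where
  "ad_sections P = {\<psi>.
     (\<forall>x\<in>points (base P). \<psi> x \<in> ad_fibre P x) \<and> (\<forall>x. x \<notin> points (base P) \<longrightarrow> \<psi> x = 0) \<and>
     (\<forall>U \<sigma> l. local_section P U \<sigma> \<and> linear_map_on (lie_alg P) (UNIV :: real set) l \<longrightarrow>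
        (\<lambda>x. if x \<in> U then l (\<psi> x (\<sigma> x)) else 0)
          \<in> smooth_functions (open_submanifold (base P) U))}"

definition sym_sections ::
  "('x, 'k, 'p) bundle_data \<Rightarrow> nat \<Rightarrow> ('x \<Rightarrow> ('k, 'p) adjoint_sym) set" where
  "sym_sections P q = {s.
     (\<forall>x\<in>points (base P). s x \<in> Sym (ad_fibre P x) q) \<and>
     (\<forall>x. x \<notin> points (base P) \<longrightarrow> s x = 0) \<and>
     (\<forall>U \<sigma> \<beta>. local_section P U \<sigma> \<and> symmetric_form_on (lie_alg P) q \<beta> \<longrightarrow>
        (\<lambda>x. if x \<in> U then s x (\<lambda>vs. \<beta> (map (\<lambda>v. v (\<sigma> x)) vs)) else 0)
          \<in> smooth_functions (open_submanifold (base P) U))}"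

subsection \<open>The operators \<open>\<iota>\<^sup>\<and>\<^sub>\<psi>\<close>\<close>

text \<open>The operator \<open>\<iota> \<psi> q x\<close> acts from \<open>Sym\<^sup>q\<close> to \<open>Sym\<^sup>q\<^sup>+\<^sup>1\<close> of the fibre over \<open>x\<close>.\<close>

type_synonym ('x, 'k, 'p) fibre_operator =
  "('x \<Rightarrow> ('k, 'p) adjoint_vec) \<Rightarrow> nat \<Rightarrow> 'x \<Rightarrow> ('k, 'p) adjoint_sym \<Rightarrow> ('k, 'p) adjoint_sym"

definition on_sections :: "('x, 'k, 'p) bundle_data \<Rightarrow> ('x, 'k, 'p) fibre_operator \<Rightarrow>
    ('x \<Rightarrow> ('k, 'p) adjoint_vec) \<Rightarrow> nat \<Rightarrow>
    ('x \<Rightarrow> ('k, 'p) adjoint_sym) \<Rightarrow> 'x \<Rightarrow> ('k, 'p) adjoint_sym" where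
  "on_sections P \<iota> \<psi> q s = (\<lambda>x. if x \<in> points (base P) then \<iota> \<psi> q x (s x) else 0)"

text \<open>The sign \<open>\<epsilon>\<close> admits both sign conventions for a derivation of degree one of the graded
  algebra \<open>Sym\<close>: the plain Leibniz rule (\<open>\<epsilon> = 1\<close>) and the graded one (\<open>\<epsilon> = -1\<close>).\<close>

definition square_zero_derivations ::
  "('x, 'k, 'p) bundle_data \<Rightarrow> ('x, 'k, 'p) fibre_operator \<Rightarrow> bool" where
  "square_zero_derivations P \<iota> \<longleftrightarrow>
     (\<forall>\<psi>\<in>ad_sections P. \<forall>q. \<forall>x\<in>points (base P).
        linear_map_on (Sym (ad_fibre P x) q) (Sym (ad_fibre P x) (Suc q)) (\<iota> \<psi> q x)) \<and>
     (\<forall>\<psi>\<in>ad_sections P. \<forall>q. \<forall>s\<in>sym_sections P q.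
        on_sections P \<iota> \<psi> q s \<in> sym_sections P (Suc q)) \<and>
     (\<exists>\<epsilon>\<in>{1, - 1}. \<forall>\<psi>\<in>ad_sections P. \<forall>q r. \<forall>x\<in>points (base P).
        \<forall>s\<in>Sym (ad_fibre P x) q. \<forall>t\<in>Sym (ad_fibre P x) r.
          \<iota> \<psi> (q + r) x (Sym_mult (ad_fibre P x) q r s t) =
            Sym_mult (ad_fibre P x) (Suc q) r (\<iota> \<psi> q x s) t +
            \<epsilon> ^ q *\<^sub>R Sym_mult (ad_fibre P x) q (Suc r) s (\<iota> \<psi> r x t)) \<and>
     (\<forall>q. \<forall>x\<in>points (base P). \<forall>s\<in>Sym (ad_fibre P x) q.
        linear_map_on (ad_sections P) UNIV (\<lambda>\<psi>. \<iota> \<psi> q x s)) \<and>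
     (\<forall>\<psi>\<in>ad_sections P. \<forall>q. \<forall>x\<in>points (base P). \<forall>s\<in>Sym (ad_fibre P x) q.
        \<iota> \<psi> (Suc q) x (\<iota> \<psi> q x s) = 0)"

section \<open>The complex\<close>

type_synonym ('x, 'k, 'p) bigraded =
  "nat \<Rightarrow> nat \<Rightarrow> ('x diff_form \<Rightarrow> ('x \<Rightarrow> ('k, 'p) adjoint_sym) \<Rightarrow> real) \<Rightarrow> real"

definition B_space :: "('x, 'k, 'p) bundle_data \<Rightarrow> nat \<Rightarrow> nat \<Rightarrow>
    (('x diff_form \<Rightarrow> ('x \<Rightarrow> ('k, 'p) adjoint_sym) \<Rightarrow> real) \<Rightarrow> real) set" where
  "B_space P p q = tensor_product (forms (base P) p) (sym_sections P q)"

definition S_space :: "('x, 'k, 'p) bundle_data \<Rightarrow> nat \<Rightarrow> ('x, 'k, 'p) bigraded set" where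
  "S_space P n = {s. \<forall>p q. if p + q = n then s p q \<in> B_space P p q else s p q = 0}"

text \<open>The \<open>(p, q)\<close> component of the result: \<open>d \<otimes> 1\<close> arrives from \<open>B\<^sub>p\<^sub>-\<^sub>1\<^sub>,\<^sub>q\<close>, and
  \<open>1 \<otimes> \<iota>\<^sup>\<and>\<^sub>\<psi>\<close> arrives from \<open>B\<^sub>p\<^sub>,\<^sub>q\<^sub>-\<^sub>1\<close>, where the de Rham degree is \<open>p\<close>.\<close>

definition D_total :: "('x, 'k, 'p) bundle_data \<Rightarrow> ('x, 'k, 'p) fibre_operator \<Rightarrow> real \<Rightarrow>
    ('x \<Rightarrow> ('k, 'p) adjoint_vec) \<Rightarrow> ('x, 'k, 'p) bigraded \<Rightarrow> ('x, 'k, 'p) bigraded" where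
  "D_total P \<iota> c \<psi> s = (\<lambda>p q.
     (case p of 0 \<Rightarrow> 0 | Suc p' \<Rightarrow>
        tensor_map (forms (base P) p) (sym_sections P q) (ext_deriv (base P) p') id (s p' q)) +
     (case q of 0 \<Rightarrow> 0 | Suc q' \<Rightarrow>
        ((- 1) ^ p * c) *\<^sub>R
          tensor_map (forms (base P) p) (sym_sections P q) id (on_sections P \<iota> \<psi> q') (s p q')))"

definition U_map :: "('x, 'k, 'p) bigraded \<Rightarrow> ('x, 'k, 'p) bigraded" where
  "U_map s = (\<lambda>p q. (- 1) ^ q *\<^sub>R s p q)"

definition J_map :: "real \<Rightarrow> ('x, 'k, 'p) bigraded \<Rightarrow> ('x, 'k, 'p) bigraded" where
  "J_map \<alpha> s = (\<lambda>p q. \<alpha> ^ q *\<^sub>R s p q)"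

definition graded_automorphism :: "(nat \<Rightarrow> 'a::real_vector set) \<Rightarrow> ('a \<Rightarrow> 'a) \<Rightarrow> bool" where
  "graded_automorphism C f \<longleftrightarrow> (\<forall>n. linear_map_on (C n) (C n) f \<and> bij_betw f (C n) (C n))"

section \<open>Cochain complexes\<close>

definition cochain_complex :: "(nat \<Rightarrow> 'a::real_vector set) \<Rightarrow> ('a \<Rightarrow> 'a) \<Rightarrow> bool" where
  "cochain_complex C d \<longleftrightarrow> (\<forall>n. subspace (C n) \<and> linear_map_on (C n) (C (Suc n)) d \<and>
     (\<forall>a\<in>C n. d (d a) = 0))"

definition chain_map :: "(nat \<Rightarrow> 'a::real_vector set) \<Rightarrow> ('a \<Rightarrow> 'a) \<Rightarrow>
    (nat \<Rightarrow> 'b::real_vector set) \<Rightarrow> ('b \<Rightarrow> 'b) \<Rightarrow> (nat \<Rightarrow> 'a \<Rightarrow> 'b) \<Rightarrow> bool" where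
  "chain_map C d C' d' f \<longleftrightarrow> (\<forall>n. linear_map_on (C n) (C' n) (f n) \<and>
     (\<forall>a\<in>C n. f (Suc n) (d a) = d' (f n a)))"

definition chain_homotopic :: "(nat \<Rightarrow> 'a::real_vector set) \<Rightarrow> ('a \<Rightarrow> 'a) \<Rightarrow>
    (nat \<Rightarrow> 'b::real_vector set) \<Rightarrow> ('b \<Rightarrow> 'b) \<Rightarrow>
    (nat \<Rightarrow> 'a \<Rightarrow> 'b) \<Rightarrow> (nat \<Rightarrow> 'a \<Rightarrow> 'b) \<Rightarrow> bool" where
  "chain_homotopic C d C' d' f g \<longleftrightarrow> (\<exists>h.
     linear_map_on (C 0) {0} (h 0) \<and> (\<forall>n. linear_map_on (C (Suc n)) (C' n) (h (Suc n))) \<and>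
     (\<forall>n. \<forall>a\<in>C n. f n a - g n a = d' (h n a) + h (Suc n) (d a)))"

definition chain_homotopy_equivalent :: "(nat \<Rightarrow> 'a::real_vector set) \<Rightarrow> ('a \<Rightarrow> 'a) \<Rightarrow>
    (nat \<Rightarrow> 'b::real_vector set) \<Rightarrow> ('b \<Rightarrow> 'b) \<Rightarrow> bool" where
  "chain_homotopy_equivalent C d C' d' \<longleftrightarrow> cochain_complex C d \<and> cochain_complex C' d' \<and>
     (\<exists>f g. chain_map C d C' d' f \<and> chain_map C' d' C d g \<and>
        chain_homotopic C d C d (\<lambda>n. g n \<circ> f n) (\<lambda>n. id) \<and>
        chain_homotopic C' d' C' d' (\<lambda>n. f n \<circ> g n) (\<lambda>n. id))"

end

theory Submission
  imports Defs
begin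

text \<open>The exterior derivative squares to zero by Cartan's calculus: each of the identities
  \<open>[L\<^sub>Y, L\<^sub>Z] = L\<^bsub>[Y,Z]\<^esub>\<close>, \<open>L\<^sub>Y d = d L\<^sub>Y\<close> and \<open>d d = 0\<close> follows by induction on the degree
  of the form from its contraction with a vector field. Together with the hypotheses on
  \<open>\<iota>\<^sup>\<and>\<^sub>\<psi>\<close> this gives \<open>D\<^sup>2 = 0\<close>, the mixed terms cancelling by the sign \<open>(-1)\<^sup>p\<close>.
  For \<open>a \<noteq> 0\<close> the rescaling \<open>a\<^sup>q\<close> on \<open>B\<^sub>p\<^sub>,\<^sub>q\<close> commutes with \<open>d\<close> and multiplies
  \<open>\<iota>\<^sup>\<and>\<^sub>\<psi>\<close>, which raises \<open>q\<close> by one, by \<open>a\<close>; \<open>U\<close> is the case \<open>a = -1\<close>. It is therefore an isomorphism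
  of complexes, and the homotopies can be taken to be zero.\<close>

section \<open>The algebra of smooth functions\<close>

text \<open>Expanding \<open>d d\<close> in the invariant formula leaves a cancellation among
  iterated alternating sums. The recursions \<open>lie_deriv\<close> and \<open>cartan_deriv\<close>
  peel off one vector field at a time instead, so that \<open>d d = 0\<close> meets sums only when
  they are matched with that formula. The price is that identities of forms hold just on tuples of
  vector fields of the right length; congruence lemmas carry them below the operators. A vector
  field is additive and Leibniz on smooth functions only, so these must first be shown to form an
  algebra. Tensors are functionals, on which \<open>tensor_map\<close> acts linearly without any
  membership condition; hence the rescaling of \<open>D_total\<close> holds on the whole ambient
  type. Membership enters where a fact is known for forms or sections only: \<open>d d = 0\<close>,
  the vanishing square of \<open>\<iota>\<close>, and the sign change from \<open>\<psi>\<close> to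
  \<open>- \<psi>\<close>. The complex for \<open>- \<psi>\<close> is reached as the one for
  \<open>\<psi>\<close> with the opposite coefficient.\<close>

lemma eventually_fun_upd_in_open:
  assumes W: "openin (Euclidean_space n) W" and v: "v \<in> W" and i: "i < n"
  shows "eventually (\<lambda>t. v(i := t) \<in> W) (nhds (v i))"
proof -
  \<comment> \<open>Points of \<open>Euclidean_space n\<close> vanish from index \<open>n\<close>
    on; as \<open>i < n\<close>, the coordinate line through \<open>v\<close> stays inside.\<close>
  have v0: "v j = 0" if "j \<ge> n" for j
    using openin_subset[OF W] v that by (auto simp: topspace_Euclidean_space)
  have "continuous_map euclideanreal (Euclidean_space n) (\<lambda>t. v(i := t))"
    unfolding Euclidean_space_def continuous_map_in_subtopology continuous_map_componentwise_UNIV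
    using i v0 by auto
  from openin_continuous_map_preimage[OF this W] have "open {t. v(i := t) \<in> W}"
    by simp
  then show ?thesis
    unfolding eventually_nhds using v by (intro exI[of _ "{t. v(i := t) \<in> W}"]) simp
qed

text \<open>Differentiation in coordinate \<open>i\<close> sees a function only along the coordinate
  line through \<open>v\<close>, and near \<open>v i\<close> this line lies in the open set
  \<open>W\<close>.\<close>

lemma
  assumes W: "openin (Euclidean_space n) W" and v: "v \<in> W" and i: "i < n"
    and eq: "\<And>w. w \<in> W \<Longrightarrow> f w = g w"
  shows partial_deriv_cong: "partial_deriv i f v = partial_deriv i g v"
    and differentiable_upd_cong: "(\<lambda>t. f (v(i := t))) differentiable (at (v i)) \<longleftrightarrow>
      (\<lambda>t. g (v(i := t))) differentiable (at (v i))"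
proof -
  have ev: "eventually (\<lambda>t. f (v(i := t)) = g (v(i := t))) (nhds (v i))"
    using eventually_fun_upd_in_open[OF W v i] by eventually_elim (rule eq)
  show "partial_deriv i f v = partial_deriv i g v"
    unfolding partial_deriv_def by (rule deriv_cong_ev[OF ev refl])
  show "(\<lambda>t. f (v(i := t))) differentiable (at (v i)) \<longleftrightarrow>
      (\<lambda>t. g (v(i := t))) differentiable (at (v i))"
    unfolding real_differentiable_def using DERIV_cong_ev[OF refl ev refl] by simp
qed

text \<open>All iterated derivatives in \<open>C_infinity_on\<close> are reduced to one derivative
  at a time. Derivatives have to stay in \<open>A\<close> only up to equality on \<open>W\<close>,
  because rules such as the product rule hold only there.\<close>

lemma C_infinity_on_coinduct:
  assumes W: "openin (Euclidean_space n) W" and "f \<in> A"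
    and cont: "\<And>f. f \<in> A \<Longrightarrow> continuous_map (subtopology (Euclidean_space n) W) euclideanreal f"
    and diff: "\<And>f i v. \<lbrakk>f \<in> A; i < n; v \<in> W\<rbrakk> \<Longrightarrow> (\<lambda>t. f (v(i := t))) differentiable (at (v i))"
    and deriv: "\<And>f i. \<lbrakk>f \<in> A; i < n\<rbrakk> \<Longrightarrow> \<exists>g\<in>A. \<forall>v\<in>W. partial_deriv i f v = g v"
  shows "C_infinity_on n W f"
proof -
  \<comment> \<open>\<open>fold\<close> differentiates \<open>f\<close> first, and the result merely
    agrees on \<open>W\<close> with a member of \<open>A\<close>; so the induction runs over all
    functions that agree with one.\<close>
  have fold_eq: "\<exists>g\<in>A. \<forall>v\<in>W. fold partial_deriv is f v = g v"
    if "is \<in> lists {..<n}" "\<exists>g\<in>A. \<forall>v\<in>W. f v = g v" for "is" f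
    using that
  proof (induction "is" arbitrary: f)
    case (Cons i "is")
    then obtain g where g: "g \<in> A" "\<forall>v\<in>W. f v = g v" and i: "i < n"
      by auto
    then obtain h where "h \<in> A" "\<forall>v\<in>W. partial_deriv i g v = h v"
      using deriv by blast
    then have "\<exists>h\<in>A. \<forall>v\<in>W. partial_deriv i f v = h v"
      using partial_deriv_cong[OF W _ i] g(2) by metis
    then show ?case
      using Cons by simp
  qed simp
  show ?thesis
    unfolding C_infinity_on_def
  proof (intro ballI conjI allI impI)
    fix "is" assume "is \<in> lists {..<n}"
    from fold_eq[OF this, of f] \<open>f \<in> A\<close>
    obtain g where g: "g \<in> A" "\<And>v. v \<in> W \<Longrightarrow> fold partial_deriv is f v = g v"
      by blast
    show "continuous_map (subtopology (Euclidean_space n) W) euclideanreal (fold partial_deriv is f)"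
      by (rule continuous_map_eq[OF cont[OF g(1)]]) (simp add: g(2))
    fix i v assume "i < n" "v \<in> W"
    then show "(\<lambda>t. fold partial_deriv is f (v(i := t))) differentiable (at (v i))"
      using differentiable_upd_cong[OF W \<open>v \<in> W\<close> \<open>i < n\<close>, of "fold partial_deriv is f" g]
        g(2) diff[OF g(1)] by simp
  qed
qed

lemma C_infinity_on_imp:
  assumes "C_infinity_on n W f"
  shows "continuous_map (subtopology (Euclidean_space n) W) euclideanreal f"
    and "\<And>i v. \<lbrakk>i < n; v \<in> W\<rbrakk> \<Longrightarrow> (\<lambda>t. f (v(i := t))) differentiable (at (v i))"
    and "\<And>i. i < n \<Longrightarrow> C_infinity_on n W (partial_deriv i f)"
proof -
  note f = assms[unfolded C_infinity_on_def, rule_format]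
  show "continuous_map (subtopology (Euclidean_space n) W) euclideanreal f"
    using f[of "[]"] by simp
  show "(\<lambda>t. f (v(i := t))) differentiable (at (v i))" if "i < n" "v \<in> W" for i v
    using f[of "[]"] that by simp
  show "C_infinity_on n W (partial_deriv i f)" if "i < n" for i
    unfolding C_infinity_on_def
  proof
    fix "is" assume "is \<in> lists {..<n}"
    then show "continuous_map (subtopology (Euclidean_space n) W) euclideanreal
          (fold partial_deriv is (partial_deriv i f)) \<and>
        (\<forall>j<n. \<forall>v\<in>W. (\<lambda>t. fold partial_deriv is (partial_deriv i f) (v(j := t)))
          differentiable (at (v j)))"
      using f[of "i # is"] that by simp
  qed
qed

text \<open>Products alone would not do as the coinduction set, since Leibniz's rule turns a product
  into a sum of products.\<close>

inductive_set C_infinity_algebra :: "nat \<Rightarrow> (nat \<Rightarrow> real) set \<Rightarrow> ((nat \<Rightarrow> real) \<Rightarrow> real) set"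
  for n W where
  base: "C_infinity_on n W f \<Longrightarrow> f \<in> C_infinity_algebra n W"
| const: "(\<lambda>v. c) \<in> C_infinity_algebra n W"
| add: "\<lbrakk>f \<in> C_infinity_algebra n W; g \<in> C_infinity_algebra n W\<rbrakk> \<Longrightarrow>
    (\<lambda>v. f v + g v) \<in> C_infinity_algebra n W"
| mult: "\<lbrakk>f \<in> C_infinity_algebra n W; g \<in> C_infinity_algebra n W\<rbrakk> \<Longrightarrow>
    (\<lambda>v. f v * g v) \<in> C_infinity_algebra n W"

text \<open>By the sum and product rules the generated algebra is closed under partial derivatives, so
  by coinduction it consists of smooth functions.\<close>

lemma C_infinity_algebra_imp_C_infinity_on:
  assumes W: "openin (Euclidean_space n) W" and f: "f \<in> C_infinity_algebra n W"
  shows "C_infinity_on n W f"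
proof (rule C_infinity_on_coinduct[OF W f])
  have diff: "(\<lambda>t. f (v(i := t))) differentiable (at (v i))"
    if "f \<in> C_infinity_algebra n W" "i < n" "v \<in> W" for f i v
    using that by induction (simp_all add: C_infinity_on_imp(2))
  then show "\<And>f i v. \<lbrakk>f \<in> C_infinity_algebra n W; i < n; v \<in> W\<rbrakk> \<Longrightarrow>
    (\<lambda>t. f (v(i := t))) differentiable (at (v i))" .
  show "continuous_map (subtopology (Euclidean_space n) W) euclideanreal f"
    if "f \<in> C_infinity_algebra n W" for f
    using that by induction
      (simp_all add: C_infinity_on_imp(1) continuous_map_add continuous_map_real_mult)
  show "\<exists>g\<in>C_infinity_algebra n W. \<forall>v\<in>W. partial_deriv i f v = g v"
    if "f \<in> C_infinity_algebra n W" and i: "i < n" for f i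
    using that(1)
  proof induction
    case (base f)
    show ?case
      by (intro bexI[OF _ C_infinity_algebra.base[OF C_infinity_on_imp(3)[OF base i]]]) simp
  next
    case (const c)
    have "partial_deriv i (\<lambda>v. c) v = 0" for v
      by (simp add: partial_deriv_def)
    then show ?case
      by (intro bexI[OF _ C_infinity_algebra.const[of 0]]) simp
  next
    case (add f g)
    then obtain f' g' where f': "f' \<in> C_infinity_algebra n W" "\<forall>v\<in>W. partial_deriv i f v = f' v"
      and g': "g' \<in> C_infinity_algebra n W" "\<forall>v\<in>W. partial_deriv i g v = g' v"
      by blast
    have "partial_deriv i (\<lambda>v. f v + g v) v = f' v + g' v" if "v \<in> W" for v
    proof -
      have "((\<lambda>t. f (v(i := t))) has_real_derivative f' v) (at (v i))"
        "((\<lambda>t. g (v(i := t))) has_real_derivative g' v) (at (v i))"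
        using f'(2) g'(2) diff[OF add(1) i that] diff[OF add(2) i that] that
        by (auto simp: partial_deriv_def simp flip: DERIV_deriv_iff_real_differentiable)
      from DERIV_add[OF this] show ?thesis
        unfolding partial_deriv_def by (intro DERIV_imp_deriv) simp
    qed
    then show ?case
      by (intro bexI[OF _ C_infinity_algebra.add[OF f'(1) g'(1)]]) simp
  next
    case (mult f g)
    then obtain f' g' where f': "f' \<in> C_infinity_algebra n W" "\<forall>v\<in>W. partial_deriv i f v = f' v"
      and g': "g' \<in> C_infinity_algebra n W" "\<forall>v\<in>W. partial_deriv i g v = g' v"
      by blast
    have "partial_deriv i (\<lambda>v. f v * g v) v = f' v * g v + f v * g' v" if "v \<in> W" for v
    proof -
      have "((\<lambda>t. f (v(i := t))) has_real_derivative f' v) (at (v i))"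
        "((\<lambda>t. g (v(i := t))) has_real_derivative g' v) (at (v i))"
        using f'(2) g'(2) diff[OF mult(1) i that] diff[OF mult(2) i that] that
        by (auto simp: partial_deriv_def simp flip: DERIV_deriv_iff_real_differentiable)
      from DERIV_mult[OF this] show ?thesis
        unfolding partial_deriv_def by (intro DERIV_imp_deriv) (simp add: algebra_simps)
    qed
    then show ?case
      by (intro bexI[OF _ C_infinity_algebra.add[OF C_infinity_algebra.mult[OF f'(1) mult(2)]
              C_infinity_algebra.mult[OF mult(1) g'(1)]]]) simp
  qed
qed

text \<open>Meant for functions cut off outside the manifold, whose chart expression has a simple
  formula only on the image of the chart. The coinduction set consists of the functions that agree
  on \<open>W\<close> with a smooth one.\<close>

lemma C_infinity_on_cong:
  assumes "openin (Euclidean_space n) W" "C_infinity_on n W g" "\<And>v. v \<in> W \<Longrightarrow> f v = g v"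
  shows "C_infinity_on n W f"
proof (rule C_infinity_on_coinduct)
  let ?A = "{f. \<exists>g. C_infinity_on n W g \<and> (\<forall>v\<in>W. f v = g v)}"
  show "openin (Euclidean_space n) W" "f \<in> ?A"
    using assms by blast+
  fix f assume "f \<in> ?A"
  then obtain g where g: "C_infinity_on n W g" "\<And>v. v \<in> W \<Longrightarrow> f v = g v"
    by blast
  show "continuous_map (subtopology (Euclidean_space n) W) euclideanreal f"
    by (rule continuous_map_eq[OF C_infinity_on_imp(1)[OF g(1)]]) (simp add: g(2))
  fix i assume i: "i < n"
  show "(\<lambda>t. f (v(i := t))) differentiable (at (v i))" if "v \<in> W" for v
    using differentiable_upd_cong[of n W v i f g, OF assms(1) that i g(2)]
      C_infinity_on_imp(2)[OF g(1) i that] by simp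
  show "\<exists>g\<in>?A. \<forall>v\<in>W. partial_deriv i f v = g v"
  proof
    show "partial_deriv i g \<in> ?A"
      using C_infinity_on_imp(3)[OF g(1) i] by blast
    show "\<forall>v\<in>W. partial_deriv i f v = partial_deriv i g v"
      using partial_deriv_cong[of _ W _ i f g, OF assms(1) _ i g(2)] by simp
  qed
qed

context
  fixes M :: "'x manifold"
  assumes M: "smooth_manifold M"
begin

lemma chart:
  assumes "(U, \<phi>) \<in> matlas M"
  shows "openin (Euclidean_space (mdim M)) (\<phi> ` U)" and "U \<subseteq> points M"
proof -
  show "openin (Euclidean_space (mdim M)) (\<phi> ` U)"
    using M assms unfolding smooth_manifold_def by blast
  have "openin (mtop M) U"
    using M assms unfolding smooth_manifold_def by blast
  then show "U \<subseteq> points M"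
    by (rule openin_subset)
qed

lemma smooth_functions_add:
  assumes "f \<in> smooth_functions M" "g \<in> smooth_functions M"
  shows "f + g \<in> smooth_functions M"
proof -
  have "C_infinity_on (mdim M) (\<phi> ` U) (\<lambda>v. f (inv_into U \<phi> v) + g (inv_into U \<phi> v))"
    if "(U, \<phi>) \<in> matlas M" for U \<phi>
    using assms that
    by (intro C_infinity_algebra_imp_C_infinity_on[OF chart(1)[OF that] C_infinity_algebra.add]
        C_infinity_algebra.base) (auto simp: smooth_functions_def)
  then show ?thesis
    using assms by (auto simp: smooth_functions_def plus_fun_def)
qed

lemma smooth_functions_mult:
  assumes "f \<in> smooth_functions M" "g \<in> smooth_functions M"
  shows "f * g \<in> smooth_functions M"
proof -
  have "C_infinity_on (mdim M) (\<phi> ` U) (\<lambda>v. f (inv_into U \<phi> v) * g (inv_into U \<phi> v))"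
    if "(U, \<phi>) \<in> matlas M" for U \<phi>
    using assms that
    by (intro C_infinity_algebra_imp_C_infinity_on[OF chart(1)[OF that] C_infinity_algebra.mult]
        C_infinity_algebra.base) (auto simp: smooth_functions_def)
  then show ?thesis
    using assms by (auto simp: smooth_functions_def times_fun_def)
qed

lemma smooth_functions_const: "(\<lambda>x. if x \<in> points M then c else 0) \<in> smooth_functions M"
proof -
  have "C_infinity_on (mdim M) (\<phi> ` U) (\<lambda>v. if inv_into U \<phi> v \<in> points M then c else 0)"
    if "(U, \<phi>) \<in> matlas M" for U \<phi>
  proof (rule C_infinity_on_cong[OF chart(1)[OF that]])
    show "C_infinity_on (mdim M) (\<phi> ` U) (\<lambda>v. c)"
      by (intro C_infinity_algebra_imp_C_infinity_on[OF chart(1)[OF that]] C_infinity_algebra.const)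
    show "(if inv_into U \<phi> v \<in> points M then c else 0) = c" if "v \<in> \<phi> ` U" for v
      using inv_into_into[OF that] chart(2)[OF \<open>(U, \<phi>) \<in> matlas M\<close>] by auto
  qed
  then show ?thesis
    by (auto simp: smooth_functions_def)
qed

lemma smooth_functions_outside: "f \<in> smooth_functions M \<Longrightarrow> x \<notin> points M \<Longrightarrow> f x = 0"
  by (simp add: smooth_functions_def)

lemma smooth_functions_scaleR:
  assumes "f \<in> smooth_functions M"
  shows "c *\<^sub>R f \<in> smooth_functions M"
proof -
  \<comment> \<open>Scaling is multiplication by the constant \<open>c\<close>, cut off outside
    \<open>points M\<close>, where \<open>f\<close> vanishes anyway.\<close>
  have "c *\<^sub>R f = (\<lambda>x. if x \<in> points M then c else 0) * f"
    using smooth_functions_outside[OF assms] by (auto simp: fun_eq_iff scaleR_fun_def)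
  then show ?thesis
    using smooth_functions_mult[OF smooth_functions_const assms] by simp
qed

lemma smooth_functions_0: "0 \<in> smooth_functions M"
  using smooth_functions_const[of 0] by (simp add: zero_fun_def)

lemma smooth_functions_uminus: "f \<in> smooth_functions M \<Longrightarrow> - f \<in> smooth_functions M"
  using smooth_functions_scaleR[of f "-1"] by simp

lemma smooth_functions_diff:
  "\<lbrakk>f \<in> smooth_functions M; g \<in> smooth_functions M\<rbrakk> \<Longrightarrow> f - g \<in> smooth_functions M"
  using smooth_functions_add[of f "- g"] smooth_functions_uminus[of g] by simp

end

section \<open>Vector fields\<close>

context
  fixes M :: "'x manifold"
  assumes M: "smooth_manifold M"
begin

lemmas smooth_closed = smooth_functions_add[OF M] smooth_functions_mult[OF M]
  smooth_functions_0[OF M] smooth_functions_uminus[OF M] smooth_functions_diff[OF M]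

text \<open>Since \<open>Y\<close> sends functions that are not smooth to 0, \<open>Y f\<close> is
  smooth for every \<open>f\<close>; closure under \<open>Y\<close> thus carries no side condition
  in later simplifications.\<close>

lemma
  assumes "Y \<in> vector_fields M"
  shows vector_field_outside: "f \<notin> smooth_functions M \<Longrightarrow> Y f = 0"
    and vector_field_closed: "Y f \<in> smooth_functions M"
    and vector_field_add: "\<lbrakk>f \<in> smooth_functions M; g \<in> smooth_functions M\<rbrakk> \<Longrightarrow> Y (f + g) = Y f + Y g"
    and vector_field_scaleR: "f \<in> smooth_functions M \<Longrightarrow> Y (c *\<^sub>R f) = c *\<^sub>R Y f"
    and vector_field_mult:
      "\<lbrakk>f \<in> smooth_functions M; g \<in> smooth_functions M\<rbrakk> \<Longrightarrow> Y (f * g) = Y f * g + f * Y g"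
proof -
  show outside: "f \<notin> smooth_functions M \<Longrightarrow> Y f = 0" for f
    using assms by (simp add: vector_fields_def)
  show "Y f \<in> smooth_functions M"
    using assms outside[of f] smooth_functions_0[OF M]
    by (cases "f \<in> smooth_functions M") (auto simp: vector_fields_def linear_map_on_def)
qed (use assms in \<open>auto simp: vector_fields_def linear_map_on_def\<close>)

lemma vector_field_0: "Y \<in> vector_fields M \<Longrightarrow> Y 0 = 0"
  using vector_field_scaleR[of Y 0 0] smooth_functions_0[OF M] by simp

lemma vector_field_uminus:
  assumes "Y \<in> vector_fields M" "f \<in> smooth_functions M"
  shows "Y (- f) = - Y f"
  using vector_field_scaleR[OF assms, of "- 1"] by simp

lemma vector_field_diff:
  assumes "Y \<in> vector_fields M" "f \<in> smooth_functions M" "g \<in> smooth_functions M"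
  shows "Y (f - g) = Y f - Y g"
  using vector_field_add[OF assms(1,2) smooth_functions_uminus[OF M assms(3)]]
    vector_field_uminus[OF assms(1,3)] by simp

lemmas vector_field_simps = vector_field_closed vector_field_add vector_field_mult
  vector_field_0 vector_field_uminus vector_field_diff vector_field_scaleR vector_field_outside

lemma vector_fieldI:
  assumes "\<And>f. f \<in> smooth_functions M \<Longrightarrow> Y f \<in> smooth_functions M"
    and "\<And>f g. \<lbrakk>f \<in> smooth_functions M; g \<in> smooth_functions M\<rbrakk> \<Longrightarrow> Y (f + g) = Y f + Y g"
    and "\<And>c f. f \<in> smooth_functions M \<Longrightarrow> Y (c *\<^sub>R f) = c *\<^sub>R Y f"
    and "\<And>f g. \<lbrakk>f \<in> smooth_functions M; g \<in> smooth_functions M\<rbrakk> \<Longrightarrow> Y (f * g) = Y f * g + f * Y g"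
    and "\<And>f. f \<notin> smooth_functions M \<Longrightarrow> Y f = 0"
  shows "Y \<in> vector_fields M"
  using assms by (auto simp: vector_fields_def linear_map_on_def)

lemma vector_fields_0: "0 \<in> vector_fields M"
  by (rule vector_fieldI) (simp_all add: smooth_closed)

lemma mult_scaleR_fun: "f * (c *\<^sub>R g) = c *\<^sub>R (f * g)" for f g :: "'x \<Rightarrow> real"
  by (simp add: fun_eq_iff scaleR_fun_def)

lemma vector_fields_module:
  assumes "f \<in> smooth_functions M" "V \<in> vector_fields M" "W \<in> vector_fields M"
  shows "(\<lambda>h. f * V h) + W \<in> vector_fields M"
  by (rule vector_fieldI) (simp_all add: assms(1) smooth_closed mult_scaleR_fun algebra_simps
    vector_field_simps[OF assms(2)] vector_field_simps[OF assms(3)])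

lemma vector_fields_uminus:
  assumes "V \<in> vector_fields M"
  shows "- V \<in> vector_fields M"
  by (rule vector_fieldI) (simp_all add: smooth_closed vector_field_simps[OF assms])

lemma vector_fields_add:
  assumes "V \<in> vector_fields M" "W \<in> vector_fields M"
  shows "V + W \<in> vector_fields M"
  by (rule vector_fieldI) (simp_all add: smooth_closed algebra_simps
    vector_field_simps[OF assms(1)] vector_field_simps[OF assms(2)])

lemma vector_fields_lie_bracket:
  assumes "Y \<in> vector_fields M" "Z \<in> vector_fields M"
  shows "lie_bracket Y Z \<in> vector_fields M"
  by (rule vector_fieldI) (simp_all add: lie_bracket_def smooth_closed algebra_simps
    vector_field_simps[OF assms(1)] vector_field_simps[OF assms(2)])

lemma lie_bracket_self: "lie_bracket Y Y = 0"
  by (simp add: lie_bracket_def fun_eq_iff)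

lemma lie_bracket_commute: "lie_bracket Z Y = - lie_bracket Y Z"
  by (simp add: lie_bracket_def fun_eq_iff)

lemma lie_bracket_jacobi:
  assumes "Y \<in> vector_fields M" "Z \<in> vector_fields M" "W \<in> vector_fields M"
  shows "lie_bracket Y (lie_bracket Z W) =
    lie_bracket (lie_bracket Y Z) W + lie_bracket Z (lie_bracket Y W)"
proof
  show "lie_bracket Y (lie_bracket Z W) f =
    (lie_bracket (lie_bracket Y Z) W + lie_bracket Z (lie_bracket Y W)) f" for f
    by (simp add: lie_bracket_def vector_field_simps[OF assms(1)] vector_field_simps[OF assms(2)]
        vector_field_simps[OF assms(3)])
qed

text \<open>The Leibniz rule for \<open>Y\<close> produces the extra term \<open>Y f\<close> times
  \<open>V\<close>. The right side is nested in the shape of the linearity axiom of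
  \<open>alt_form\<close>, which can then be applied twice.\<close>

lemma lie_bracket_module:
  assumes "f \<in> smooth_functions M"
    and "Y \<in> vector_fields M" "V \<in> vector_fields M" "W \<in> vector_fields M"
  shows "lie_bracket Y ((\<lambda>h. f * V h) + W) =
    (\<lambda>h. f * lie_bracket Y V h) + ((\<lambda>h. Y f * V h) + lie_bracket Y W)"
proof
  show "lie_bracket Y ((\<lambda>h. f * V h) + W) h =
    ((\<lambda>h. f * lie_bracket Y V h) + ((\<lambda>h. Y f * V h) + lie_bracket Y W)) h" for h
    using assms(1) by (simp add: lie_bracket_def smooth_closed algebra_simps
        vector_field_simps[OF assms(2)] vector_field_simps[OF assms(3)] vector_field_simps[OF assms(4)])
qed

end

section \<open>Alternating forms, Lie derivative and exterior derivative\<close>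

text \<open>A recursive description of \<open>forms M p\<close>, except that nothing is asked outside the \<open>p\<close>-tuples of
  vector fields. Here \<open>\<lambda>Zs. \<omega> (V # Zs)\<close> is the interior product of \<open>\<omega>\<close> with \<open>V\<close>.\<close>

primrec alt_form :: "'x manifold \<Rightarrow> nat \<Rightarrow> 'x diff_form \<Rightarrow> bool" where
  "alt_form M 0 \<omega> \<longleftrightarrow> \<omega> [] \<in> smooth_functions M"
| "alt_form M (Suc p) \<omega> \<longleftrightarrow> (\<forall>V\<in>vector_fields M. alt_form M p (\<lambda>Zs. \<omega> (V # Zs))) \<and>
     (\<forall>f\<in>smooth_functions M. \<forall>V\<in>vector_fields M. \<forall>W\<in>vector_fields M.
        \<forall>Zs\<in>lists (vector_fields M). length Zs = p \<longrightarrow>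
          \<omega> (((\<lambda>h. f * V h) + W) # Zs) = f * \<omega> (V # Zs) + \<omega> (W # Zs)) \<and>
     (\<forall>V\<in>vector_fields M. \<forall>Zs\<in>lists (vector_fields M). Suc (length Zs) = p \<longrightarrow>
        \<omega> (V # V # Zs) = 0)"

text \<open>Cartan's formulas \<open>i\<^sub>Z L\<^sub>Y = L\<^sub>Y i\<^sub>Z - i\<^bsub>[Y,Z]\<^esub>\<close> and
  \<open>i\<^sub>Y d = L\<^sub>Y - d i\<^sub>Y\<close> serve as recursive definitions of \<open>L\<^sub>Y\<close> and \<open>d\<close>.\<close>

primrec lie_deriv :: "'x vector_field \<Rightarrow> 'x diff_form \<Rightarrow> 'x diff_form" where
  "lie_deriv Y \<omega> [] = Y (\<omega> [])"
| "lie_deriv Y \<omega> (Z # Zs) = lie_deriv Y (\<lambda>Zs. \<omega> (Z # Zs)) Zs - \<omega> (lie_bracket Y Z # Zs)"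

primrec cartan_deriv :: "'x diff_form \<Rightarrow> 'x diff_form" where
  "cartan_deriv \<omega> [] = 0"
| "cartan_deriv \<omega> (Y # Zs) = lie_deriv Y \<omega> Zs - cartan_deriv (\<lambda>Zs. \<omega> (Y # Zs)) Zs"

text \<open>The part of \<open>alt_form\<close> on which additivity of \<open>lie_deriv\<close> and
  \<open>cartan_deriv\<close> rests: vector fields are additive on smooth functions only.\<close>

definition smooth_valued :: "'x manifold \<Rightarrow> nat \<Rightarrow> 'x diff_form \<Rightarrow> bool" where
  "smooth_valued M p \<omega> \<longleftrightarrow>
     (\<forall>Zs\<in>lists (vector_fields M). length Zs = p \<longrightarrow> \<omega> Zs \<in> smooth_functions M)"

lemma smooth_valued_Cons:
  "smooth_valued M (Suc p) \<omega> \<Longrightarrow> V \<in> vector_fields M \<Longrightarrow> smooth_valued M p (\<lambda>Zs. \<omega> (V # Zs))"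
  by (simp add: smooth_valued_def)

lemma alt_form_imp_smooth_valued: "alt_form M p \<omega> \<Longrightarrow> smooth_valued M p \<omega>"
proof (induction p arbitrary: \<omega>)
  case (Suc p)
  show ?case
    unfolding smooth_valued_def
  proof (intro ballI impI)
    fix Zs assume Zs: "Zs \<in> lists (vector_fields M)" "length Zs = Suc p"
    then obtain V Ws where "Zs = V # Ws"
      by (cases Zs) auto
    with Zs Suc.prems Suc.IH[of "\<lambda>Zs. \<omega> (V # Zs)"] show "\<omega> Zs \<in> smooth_functions M"
      by (simp add: smooth_valued_def)
  qed
qed (simp add: smooth_valued_def)

lemma alt_form_value:
  "\<lbrakk>alt_form M p \<omega>; Zs \<in> lists (vector_fields M); length Zs = p\<rbrakk> \<Longrightarrow> \<omega> Zs \<in> smooth_functions M"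
  using alt_form_imp_smooth_valued by (auto simp: smooth_valued_def)

context
  fixes M :: "'x manifold"
  assumes M: "smooth_manifold M"
begin

lemmas vf = vector_field_closed[OF M] smooth_closed[OF M] vector_fields_0[OF M] vector_fields_module[OF M]
  vector_fields_uminus[OF M] vector_fields_add[OF M] vector_fields_lie_bracket[OF M]

context
  fixes \<omega> p
  assumes \<omega>: "alt_form M (Suc p) \<omega>"
begin

lemma alt_form_add:
  assumes "V \<in> vector_fields M" "W \<in> vector_fields M" "Zs \<in> lists (vector_fields M)" "length Zs = p"
  shows "\<omega> ((V + W) # Zs) = \<omega> (V # Zs) + \<omega> (W # Zs)"
proof -
  \<comment> \<open>The unit of the algebra of smooth functions. With it as coefficient, the
    linearity axiom of \<open>alt_form\<close> becomes additivity.\<close>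
  let ?u = "\<lambda>x. if x \<in> points M then 1 else 0"
  have u: "?u * f = f" if "f \<in> smooth_functions M" for f
    using smooth_functions_outside[OF M that] by (auto simp: fun_eq_iff)
  have "(\<lambda>h. ?u * V h) = V"
    using u[OF vector_field_closed[OF M assms(1)]] by simp
  moreover have "?u * \<omega> (V # Zs) = \<omega> (V # Zs)"
    by (rule u[OF alt_form_value[OF \<omega>]]) (use assms in auto)
  ultimately show ?thesis
    using \<omega> smooth_functions_const[OF M, of 1] assms by fastforce
qed

lemma alt_form_zero:
  assumes "Zs \<in> lists (vector_fields M)" "length Zs = p"
  shows "\<omega> (0 # Zs) = 0"
  using alt_form_add[of 0 0 Zs] assms vector_fields_0[OF M] by simp

lemma alt_form_uminus:
  assumes "V \<in> vector_fields M" "Zs \<in> lists (vector_fields M)" "length Zs = p"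
  shows "\<omega> (- V # Zs) = - \<omega> (V # Zs)"
proof -
  have "\<omega> (- V # Zs) + \<omega> (V # Zs) = \<omega> ((- V + V) # Zs)"
    using alt_form_add[of "- V" V Zs] assms vector_fields_uminus[OF M, of V] by simp
  then show ?thesis
    unfolding eq_neg_iff_add_eq_0 using alt_form_zero[of Zs] assms by simp
qed

end

text \<open>Polarisation: expand the vanishing value of \<open>\<omega>\<close> on
  \<open>V + W\<close> repeated in the first two slots. Additivity in the second slot is that of the
  contraction with the first field.\<close>

lemma alt_form_skew:
  assumes \<omega>: "alt_form M (Suc p) \<omega>" and "V \<in> vector_fields M" "W \<in> vector_fields M"
    and "Zs \<in> lists (vector_fields M)" "Suc (length Zs) = p"
  shows "\<omega> (V # W # Zs) = - \<omega> (W # V # Zs)"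
proof -
  have [simp]: "V + W \<in> vector_fields M"
    using assms by (intro vector_fields_add[OF M])
  have alt: "\<omega> (X # X # Zs) = 0" if "X \<in> vector_fields M" for X
    using assms that by simp
  have "\<omega> (X # (V + W) # Zs) = \<omega> (X # V # Zs) + \<omega> (X # W # Zs)" if "X \<in> vector_fields M" for X
    using alt_form_add[of "length Zs" "\<lambda>Zs. \<omega> (X # Zs)" V W Zs] assms that by force
  moreover have "\<omega> ((V + W) # X # Zs) = \<omega> (V # X # Zs) + \<omega> (W # X # Zs)"
    if "X \<in> vector_fields M" for X
    using alt_form_add[of p \<omega> V W "X # Zs"] assms that by simp
  ultimately have "\<omega> (V # W # Zs) + \<omega> (W # V # Zs) = 0"
    using alt[of "V + W"] alt[of V] alt[of W] assms(2,3) by (simp add: add.commute)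
  then show ?thesis
    by (rule eq_neg_iff_add_eq_0[THEN iffD2])
qed

section \<open>The Lie derivative of alternating forms\<close>

lemma alt_form_diff:
  "\<lbrakk>alt_form M p \<omega>; alt_form M p \<eta>\<rbrakk> \<Longrightarrow> alt_form M p (\<lambda>Zs. \<omega> Zs - \<eta> Zs)"
  by (induction p arbitrary: \<omega> \<eta>) (simp_all add: smooth_functions_diff[OF M] algebra_simps)

lemma lie_deriv_cong:
  assumes "Y \<in> vector_fields M"
    and "\<And>Zs. Zs \<in> lists (vector_fields M) \<Longrightarrow> length Zs = p \<Longrightarrow> \<omega> Zs = \<eta> Zs"
    and "Zs \<in> lists (vector_fields M)" "length Zs = p"
  shows "lie_deriv Y \<omega> Zs = lie_deriv Y \<eta> Zs"
  using assms(2-)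
proof (induction Zs arbitrary: \<omega> \<eta> p)
  case (Cons Z Zs)
  have "lie_deriv Y (\<lambda>Zs. \<omega> (Z # Zs)) Zs = lie_deriv Y (\<lambda>Zs. \<eta> (Z # Zs)) Zs"
    by (rule Cons.IH[of "length Zs"]) (use Cons.prems in auto)
  then show ?case
    using Cons.prems assms(1) vf by auto
qed simp

text \<open>The factor \<open>f\<close> passes through the bracket terms of the recursion unchanged;
  only the base case, where \<open>Y\<close> differentiates a function, contributes
  \<open>Y f\<close>.\<close>

lemma lie_deriv_module:
  assumes "Y \<in> vector_fields M" "f \<in> smooth_functions M"
    and "smooth_valued M p \<omega>" "smooth_valued M p \<eta>"
    and "Zs \<in> lists (vector_fields M)" "length Zs = p"
  shows "lie_deriv Y (\<lambda>Zs. f * \<omega> Zs + \<eta> Zs) Zs =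
    f * lie_deriv Y \<omega> Zs + Y f * \<omega> Zs + lie_deriv Y \<eta> Zs"
  using assms(3-)
proof (induction Zs arbitrary: \<omega> \<eta> p)
  case Nil
    have sm: "\<omega> [] \<in> smooth_functions M" "\<eta> [] \<in> smooth_functions M"
      using Nil by (simp_all add: smooth_valued_def)
    show ?case
      unfolding lie_deriv.simps vector_field_add[OF M assms(1) smooth_closed(2)[OF M assms(2) sm(1)] sm(2)]
        vector_field_mult[OF M assms(1,2) sm(1)] by (simp only: add_ac)
next
  case (Cons Z Zs)
  have IH: "lie_deriv Y (\<lambda>Zs. f * \<omega> (Z # Zs) + \<eta> (Z # Zs)) Zs = f * lie_deriv Y (\<lambda>Zs. \<omega> (Z # Zs)) Zs
    + Y f * \<omega> (Z # Zs) + lie_deriv Y (\<lambda>Zs. \<eta> (Z # Zs)) Zs"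
    by (rule Cons.IH[of "length Zs"]) (use Cons.prems in \<open>auto simp: smooth_valued_Cons\<close>)
  show ?case
    unfolding lie_deriv.simps IH by (simp add: algebra_simps)
qed

lemma lie_deriv_diff:
  assumes "Y \<in> vector_fields M"
    and "smooth_valued M p \<omega>" "smooth_valued M p \<eta>"
    and "Zs \<in> lists (vector_fields M)" "length Zs = p"
  shows "lie_deriv Y (\<lambda>Zs. \<omega> Zs - \<eta> Zs) Zs = lie_deriv Y \<omega> Zs - lie_deriv Y \<eta> Zs"
  using assms(2-)
proof (induction Zs arbitrary: \<omega> \<eta> p)
  case Nil
  then show ?case
    unfolding lie_deriv.simps
    by (intro vector_field_diff[OF M assms(1)]) (simp_all add: smooth_valued_def)
next
  case (Cons Z Zs)
  have IH: "lie_deriv Y (\<lambda>Zs. \<omega> (Z # Zs) - \<eta> (Z # Zs)) Zs =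
    lie_deriv Y (\<lambda>Zs. \<omega> (Z # Zs)) Zs - lie_deriv Y (\<lambda>Zs. \<eta> (Z # Zs)) Zs"
    by (rule Cons.IH[of "length Zs"]) (use Cons.prems in \<open>auto simp: smooth_valued_Cons\<close>)
  show ?case
    unfolding lie_deriv.simps IH by (simp add: algebra_simps)
qed

lemma lie_deriv_zero:
  assumes "Y \<in> vector_fields M"
  shows "lie_deriv Y (\<lambda>Zs. 0) Zs = 0"
  by (induction Zs) (simp_all only: lie_deriv.simps vector_field_0[OF M assms] diff_0_right)

text \<open>Linearity over functions survives because the term with \<open>Y f\<close> arises twice,
  from differentiating the coefficient and from the bracket with \<open>f V + W\<close>, with
  opposite signs.\<close>

lemma alt_form_lie_deriv:
  assumes Y: "Y \<in> vector_fields M"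
  shows "alt_form M p \<omega> \<Longrightarrow> alt_form M p (lie_deriv Y \<omega>)"
proof (induction p arbitrary: \<omega>)
  case 0
  then show ?case
    using Y by (simp add: vf)
next
  case (Suc p)
  show ?case
    unfolding alt_form.simps(2)
  proof (intro conjI ballI impI)
    fix V assume V: "V \<in> vector_fields M"
    show "alt_form M p (\<lambda>Zs. lie_deriv Y \<omega> (V # Zs))"
      unfolding lie_deriv.simps
      by (intro alt_form_diff Suc.IH) (use Suc.prems V Y vf in auto)
  next
    fix f V W Zs
    assume f: "f \<in> smooth_functions M" and V: "V \<in> vector_fields M" and W: "W \<in> vector_fields M"
      and Zs: "Zs \<in> lists (vector_fields M)" "length Zs = p"
    let ?X = "(\<lambda>h. f * V h) + W"
    have mod: "\<omega> (((\<lambda>h. g * S h) + T) # Zs) = g * \<omega> (S # Zs) + \<omega> (T # Zs)"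
      if "g \<in> smooth_functions M" "S \<in> vector_fields M" "T \<in> vector_fields M"
        "Zs \<in> lists (vector_fields M)" "length Zs = p" for g S T Zs
      using Suc.prems that by auto
    have sv: "smooth_valued M p (\<lambda>Zs. \<omega> (S # Zs))" if "S \<in> vector_fields M" for S
      using alt_form_imp_smooth_valued[OF Suc.prems] that by (rule smooth_valued_Cons)
    have "lie_deriv Y (\<lambda>Zs. \<omega> (?X # Zs)) Zs =
      lie_deriv Y (\<lambda>Zs. f * \<omega> (V # Zs) + \<omega> (W # Zs)) Zs"
      by (rule lie_deriv_cong[OF Y mod Zs]) (use f V W in auto)
    also have "\<dots> = f * lie_deriv Y (\<lambda>Zs. \<omega> (V # Zs)) Zs + Y f * \<omega> (V # Zs) +
        lie_deriv Y (\<lambda>Zs. \<omega> (W # Zs)) Zs"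
      by (rule lie_deriv_module[OF Y f sv sv Zs]) (use V W in auto)
    finally have 1: "lie_deriv Y (\<lambda>Zs. \<omega> (?X # Zs)) Zs = \<dots>" .
    have "\<omega> (lie_bracket Y ?X # Zs) =
      f * \<omega> (lie_bracket Y V # Zs) + (Y f * \<omega> (V # Zs) + \<omega> (lie_bracket Y W # Zs))"
      unfolding lie_bracket_module[OF M f Y V W]
      using f V W Y Zs by (simp add: mod vf)
    with 1 show "lie_deriv Y \<omega> (?X # Zs) = f * lie_deriv Y \<omega> (V # Zs) + lie_deriv Y \<omega> (W # Zs)"
      by (simp add: algebra_simps)
  next
    fix V Zs
    assume V: "V \<in> vector_fields M" and Zs: "Zs \<in> lists (vector_fields M)" "Suc (length Zs) = p"
    \<comment> \<open>Unfolding the recursion twice leaves this term and the values on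
      \<open>V, [Y, V]\<close> and on \<open>[Y, V], V\<close>, which cancel by skew
      symmetry.\<close>
    have "lie_deriv Y (\<lambda>Zs. \<omega> (V # V # Zs)) Zs = lie_deriv Y (\<lambda>Zs. 0) Zs"
      by (rule lie_deriv_cong[OF Y _ Zs(1) refl]) (use Suc.prems V Zs in auto)
    moreover have "\<omega> (lie_bracket Y V # V # Zs) = - \<omega> (V # lie_bracket Y V # Zs)"
      by (rule alt_form_skew[OF Suc.prems]) (use V Y Zs vf in auto)
    ultimately show "lie_deriv Y \<omega> (V # V # Zs) = 0"
      using lie_deriv_zero[OF Y] by simp
  qed
qed

text \<open>For functions this is the definition of the bracket. After contraction with
  \<open>W\<close>, the terms with a single bracket occur in both orders and cancel, and the double
  brackets combine by the Jacobi identity.\<close>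

lemma lie_deriv_commutator:
  assumes Y: "Y \<in> vector_fields M" and Z: "Z \<in> vector_fields M"
    and "alt_form M p \<omega>" "Ws \<in> lists (vector_fields M)" "length Ws = p"
  shows "lie_deriv Y (lie_deriv Z \<omega>) Ws - lie_deriv Z (lie_deriv Y \<omega>) Ws =
    lie_deriv (lie_bracket Y Z) \<omega> Ws"
  using assms(3-)
proof (induction Ws arbitrary: \<omega> p)
  case Nil
  then show ?case
    by (simp add: lie_bracket_def)
next
  case (Cons W Ws)
  then obtain W: "W \<in> vector_fields M" and Ws: "Ws \<in> lists (vector_fields M)" "length Ws = length Ws"
    and \<omega>: "alt_form M (Suc (length Ws)) \<omega>"
    by auto
  have inner: "alt_form M (length Ws) (\<lambda>Zs. \<omega> (V # Zs))" if "V \<in> vector_fields M" for V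
    using \<omega> that by simp
  have *: "lie_deriv S (lie_deriv T \<omega>) (W # Ws) =
    lie_deriv S (lie_deriv T (\<lambda>Ws. \<omega> (W # Ws))) Ws - lie_deriv S (\<lambda>Ws. \<omega> (lie_bracket T W # Ws)) Ws
    - lie_deriv T (\<lambda>Ws. \<omega> (lie_bracket S W # Ws)) Ws + \<omega> (lie_bracket T (lie_bracket S W) # Ws)"
    if S: "S \<in> vector_fields M" and T: "T \<in> vector_fields M" for S T
    using lie_deriv_diff[OF S alt_form_imp_smooth_valued[OF alt_form_lie_deriv[OF T inner[OF W]]]
        alt_form_imp_smooth_valued[OF inner[OF vector_fields_lie_bracket[OF M T W]]] Ws]
    by simp
  have "\<omega> (lie_bracket Y (lie_bracket Z W) # Ws) =
      \<omega> (lie_bracket (lie_bracket Y Z) W # Ws) + \<omega> (lie_bracket Z (lie_bracket Y W) # Ws)"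
    unfolding lie_bracket_jacobi[OF M Y Z W]
    by (rule alt_form_add[OF \<omega>]) (use Y Z W Ws vf in auto)
  \<comment> \<open>The remaining bookkeeping as an identity of variables: \<open>b\<close> and
    \<open>c\<close> are the mixed terms, \<open>e\<close> and \<open>e'\<close> the values on
    double brackets, \<open>f\<close> the value on \<open>[[Y, Z], W]\<close>.\<close>
  moreover have "a - b - c + e - (a' - c - b + e') = d - f" if "a - a' = d" "e' = f + e"
    for a a' b c d e e' f :: "'x \<Rightarrow> real"
    using that by (simp add: algebra_simps)
  ultimately show ?case
    unfolding *[OF Y Z] *[OF Z Y] lie_deriv.simps(2)[of "lie_bracket Y Z"]
    using Cons.IH[OF inner[OF W] Ws] by blast
qed

end

section \<open>The exterior derivative by Cartan's recursion\<close>

context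
  fixes M :: "'x manifold"
  assumes M: "smooth_manifold M"
begin

lemmas smooth_valued_lie_deriv = alt_form_imp_smooth_valued[OF alt_form_lie_deriv[OF M]]

lemma alt_form_inner: "\<lbrakk>alt_form M (Suc p) \<omega>; V \<in> vector_fields M\<rbrakk> \<Longrightarrow> alt_form M p (\<lambda>Zs. \<omega> (V # Zs))"
  by simp

lemma cartan_deriv_diff:
  assumes "smooth_valued M p \<omega>" "smooth_valued M p \<eta>"
    and "Zs \<in> lists (vector_fields M)" "length Zs = Suc p"
  shows "cartan_deriv (\<lambda>Zs. \<omega> Zs - \<eta> Zs) Zs = cartan_deriv \<omega> Zs - cartan_deriv \<eta> Zs"
  using assms
proof (induction p arbitrary: \<omega> \<eta> Zs)
  case 0
  then obtain Y where Zs: "Zs = [Y]" and Y: "Y \<in> vector_fields M"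
    by (cases Zs) auto
  show ?case
    unfolding Zs cartan_deriv.simps
    using lie_deriv_diff[OF M Y 0(1,2), of "[]"] by simp
next
  case (Suc p)
  then obtain Y Ws where Zs: "Zs = Y # Ws" and Y: "Y \<in> vector_fields M"
    and Ws: "Ws \<in> lists (vector_fields M)" "length Ws = Suc p"
    by (cases Zs) auto
  have "cartan_deriv (\<lambda>Zs. \<omega> (Y # Zs) - \<eta> (Y # Zs)) Ws =
    cartan_deriv (\<lambda>Zs. \<omega> (Y # Zs)) Ws - cartan_deriv (\<lambda>Zs. \<eta> (Y # Zs)) Ws"
    by (intro Suc.IH smooth_valued_Cons Suc.prems Y Ws)
  then show ?case
    unfolding Zs cartan_deriv.simps lie_deriv_diff[OF M Y Suc.prems(1,2) Ws]
    by (simp only:) (simp add: algebra_simps)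
qed

lemma cartan_deriv_cong:
  assumes "\<And>Zs. Zs \<in> lists (vector_fields M) \<Longrightarrow> length Zs = p \<Longrightarrow> \<omega> Zs = \<eta> Zs"
    and "Zs \<in> lists (vector_fields M)" "length Zs = Suc p"
  shows "cartan_deriv \<omega> Zs = cartan_deriv \<eta> Zs"
  using assms
proof (induction p arbitrary: \<omega> \<eta> Zs)
  case 0
  then obtain Y where Zs: "Zs = [Y]"
    by (cases Zs) auto
  show ?case
    unfolding Zs using 0(1)[of "[]"] by simp
next
  case (Suc p)
  then obtain Y Ws where Zs: "Zs = Y # Ws" and Y: "Y \<in> vector_fields M"
    and Ws: "Ws \<in> lists (vector_fields M)" "length Ws = Suc p"
    by (cases Zs) auto
  have "cartan_deriv (\<lambda>Zs. \<omega> (Y # Zs)) Ws = cartan_deriv (\<lambda>Zs. \<eta> (Y # Zs)) Ws"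
    by (rule Suc.IH) (use Suc.prems(1) Y Ws in auto)
  then show ?case
    unfolding Zs cartan_deriv.simps
    using lie_deriv_cong[OF M Y Suc.prems(1) Ws] by (simp only:)
qed

lemma cartan_deriv_zero:
  assumes "Zs \<in> lists (vector_fields M)"
  shows "cartan_deriv (\<lambda>Zs. 0) Zs = 0"
  using assms
proof (induction Zs)
  case (Cons Z Zs)
  show ?case
    unfolding cartan_deriv.simps Cons.IH lie_deriv_zero[OF M Cons.hyps(1)] by simp
qed simp

lemma cartan_deriv_uminus:
  assumes "smooth_valued M p \<omega>" "Zs \<in> lists (vector_fields M)" "length Zs = Suc p"
  shows "cartan_deriv (\<lambda>Zs. - \<omega> Zs) Zs = - cartan_deriv \<omega> Zs"
proof -
  have "cartan_deriv (\<lambda>Zs. 0 - \<omega> Zs) Zs = cartan_deriv (\<lambda>Zs. 0) Zs - cartan_deriv \<omega> Zs"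
    by (rule cartan_deriv_diff[OF _ assms]) (simp add: smooth_valued_def smooth_functions_0[OF M])
  then show ?thesis
    unfolding cartan_deriv_zero[OF assms(2)] by (simp only: diff_0)
qed

text \<open>Both follow from
  \<open>i\<^sub>W i\<^sub>V d = i\<^sub>W L\<^sub>V - L\<^sub>W i\<^sub>V + d i\<^sub>W i\<^sub>V = - i\<^bsub>[V,W]\<^esub> + L\<^sub>V i\<^sub>W - L\<^sub>W i\<^sub>V + d i\<^sub>W i\<^sub>V\<close>.\<close>

lemma
  assumes \<omega>: "alt_form M (Suc p) \<omega>"
    and V: "V \<in> vector_fields M" and W: "W \<in> vector_fields M"
    and Zs: "Zs \<in> lists (vector_fields M)" "length Zs = p"
  shows cartan_deriv_skew: "cartan_deriv \<omega> (V # W # Zs) = - cartan_deriv \<omega> (W # V # Zs)"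
    and cartan_deriv_alternating: "cartan_deriv \<omega> (V # V # Zs) = 0"
proof -
  have eq: "cartan_deriv \<omega> (X # Y # Zs) = lie_deriv X (\<lambda>Zs. \<omega> (Y # Zs)) Zs -
    \<omega> (lie_bracket X Y # Zs) - lie_deriv Y (\<lambda>Zs. \<omega> (X # Zs)) Zs +
    cartan_deriv (\<lambda>Zs. \<omega> (X # Y # Zs)) Zs" for X Y
    unfolding cartan_deriv.simps lie_deriv.simps by (simp only: diff_diff_eq2 diff_add_eq)
  have skew: "cartan_deriv (\<lambda>Zs. \<omega> (V # W # Zs)) Zs = - cartan_deriv (\<lambda>Zs. \<omega> (W # V # Zs)) Zs"
  \<comment> \<open>For \<open>p = 0\<close> the list \<open>Zs\<close> is empty and
    \<open>cartan_deriv\<close> vanishes on it by definition; the congruence lemma speaks of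
    nonempty lists only.\<close>
  proof (cases p)
    case 0
    then show ?thesis
      using Zs by simp
  next
    case (Suc k)
    have "cartan_deriv (\<lambda>Zs. \<omega> (V # W # Zs)) Zs = cartan_deriv (\<lambda>Zs. - \<omega> (W # V # Zs)) Zs"
      by (rule cartan_deriv_cong[where p = k]) (use alt_form_skew[OF M \<omega> V W] Zs Suc in auto)
    also have "\<dots> = - cartan_deriv (\<lambda>Zs. \<omega> (W # V # Zs)) Zs"
      by (rule cartan_deriv_uminus[where p = k])
        (use alt_form_imp_smooth_valued[OF \<omega>] Zs Suc V W in \<open>auto simp: smooth_valued_def\<close>)
    finally show ?thesis .
  qed
  have br: "\<omega> (lie_bracket W V # Zs) = - \<omega> (lie_bracket V W # Zs)"
    unfolding lie_bracket_commute[OF M, of W V]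
    by (rule alt_form_uminus[OF M \<omega> vector_fields_lie_bracket[OF M V W] Zs])
  show "cartan_deriv \<omega> (V # W # Zs) = - cartan_deriv \<omega> (W # V # Zs)"
    unfolding eq skew br by (simp add: algebra_simps)
  have "cartan_deriv (\<lambda>Zs. \<omega> (V # V # Zs)) Zs = 0"
  proof (cases p)
    case 0
    then show ?thesis
      using Zs by simp
  next
    case (Suc k)
    have "cartan_deriv (\<lambda>Zs. \<omega> (V # V # Zs)) Zs = cartan_deriv (\<lambda>Zs. 0) Zs"
      by (rule cartan_deriv_cong[where p = k]) (use \<omega> V Zs Suc in auto)
    then show ?thesis
      using cartan_deriv_zero[OF Zs(1)] by simp
  qed
  then show "cartan_deriv \<omega> (V # V # Zs) = 0"
    unfolding eq lie_bracket_self[OF M] using alt_form_zero[OF M \<omega> Zs] by simp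
qed

text \<open>The first slot is not directly accessible, since \<open>lie_deriv\<close> is not linear
  over functions in its vector field. Skew symmetry moves the argument to the second slot, where the
  contraction \<open>lie_deriv X \<omega>\<close> minus the derivative of a form of lower degree is
  alternating by induction.\<close>

lemma alt_form_cartan_deriv: "alt_form M p \<omega> \<Longrightarrow> alt_form M (Suc p) (cartan_deriv \<omega>)"
proof (induction p arbitrary: \<omega>)
  case 0
  then show ?case
    using vector_field_closed[OF M] by (simp add: fun_eq_iff)
next
  case (Suc p)
  have inner: "alt_form M (Suc p) (\<lambda>Zs. cartan_deriv \<omega> (V # Zs))" if V: "V \<in> vector_fields M" for V
    unfolding cartan_deriv.simps
    by (intro alt_form_diff[OF M] alt_form_lie_deriv[OF M V] Suc alt_form_inner[OF Suc.prems V])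
  show ?case
    unfolding alt_form.simps(2)[of M "Suc p"]
  proof (intro conjI ballI impI)
    show "alt_form M (Suc p) (\<lambda>Zs. cartan_deriv \<omega> (V # Zs))" if "V \<in> vector_fields M" for V
      by (rule inner[OF that])
    show "cartan_deriv \<omega> (V # V # Zs) = 0"
      if "V \<in> vector_fields M" "Zs \<in> lists (vector_fields M)" "Suc (length Zs) = Suc p" for V Zs
      using cartan_deriv_alternating[OF Suc.prems that(1) that(1) that(2)] that(3) by simp
    fix f V W Zs
    assume f: "f \<in> smooth_functions M" and V: "V \<in> vector_fields M" and W: "W \<in> vector_fields M"
      and "Zs \<in> lists (vector_fields M)" "length Zs = Suc p"
    then obtain X Xs where Zs: "Zs = X # Xs" and X: "X \<in> vector_fields M"
      and Xs: "Xs \<in> lists (vector_fields M)" "length Xs = p"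
      by (cases Zs) auto
    have fVW: "(\<lambda>h. f * V h) + W \<in> vector_fields M"
      by (rule vector_fields_module[OF M f V W])
    have "cartan_deriv \<omega> (X # ((\<lambda>h. f * V h) + W) # Xs) =
      f * cartan_deriv \<omega> (X # V # Xs) + cartan_deriv \<omega> (X # W # Xs)"
      using inner[OF X] f V W Xs unfolding alt_form.simps(2) by blast
    then show "cartan_deriv \<omega> (((\<lambda>h. f * V h) + W) # Zs) =
      f * cartan_deriv \<omega> (V # Zs) + cartan_deriv \<omega> (W # Zs)"
      unfolding Zs cartan_deriv_skew[OF Suc.prems fVW X Xs] cartan_deriv_skew[OF Suc.prems V X Xs]
        cartan_deriv_skew[OF Suc.prems W X Xs]
      by (simp add: algebra_simps del: cartan_deriv.simps)
  qed
qed

lemma smooth_valued_cartan_deriv: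
  assumes "alt_form M (Suc p) \<omega>" "V \<in> vector_fields M"
  shows "smooth_valued M (Suc p) (cartan_deriv (\<lambda>Zs. \<omega> (V # Zs)))"
  by (intro alt_form_imp_smooth_valued alt_form_cartan_deriv alt_form_inner assms)

text \<open>Write \<open>i_Z\<close> for the contraction with \<open>Z\<close>. Then
  \<open>i_Z d L_Y\<close> is \<open>L_Z L_Y - d L_Y i_Z + d i_[Y,Z]\<close>, and
  \<open>i_Z L_Y d\<close> is \<open>L_Y L_Z - L_Y d i_Z - L_[Y,Z] + d i_[Y,Z]\<close>. The
  induction hypothesis for \<open>i_Z \<omega>\<close> and the commutator identity make them
  equal.\<close>

lemma cartan_deriv_lie_deriv:
  assumes Y: "Y \<in> vector_fields M" and "alt_form M p \<omega>"
    and "Zs \<in> lists (vector_fields M)" "length Zs = Suc p"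
  shows "cartan_deriv (lie_deriv Y \<omega>) Zs = lie_deriv Y (cartan_deriv \<omega>) Zs"
  using assms(2-)
proof (induction p arbitrary: \<omega> Zs)
  case 0
  then obtain Z where Zs: "Zs = [Z]" and Z: "Z \<in> vector_fields M"
    by (cases Zs) auto
  show ?case
    unfolding Zs by (simp add: lie_bracket_def)
next
  case (Suc p)
  then obtain Z Ws where Zs: "Zs = Z # Ws" and Z: "Z \<in> vector_fields M"
    and Ws: "Ws \<in> lists (vector_fields M)" "length Ws = Suc p"
    by (cases Zs) auto
  have YZ: "lie_bracket Y Z \<in> vector_fields M"
    by (rule vector_fields_lie_bracket[OF M Y Z])
  note inner = alt_form_inner[OF Suc.prems(1)]
  have 1: "cartan_deriv (\<lambda>Ws. lie_deriv Y (\<lambda>Zs. \<omega> (Z # Zs)) Ws - \<omega> (lie_bracket Y Z # Ws)) Ws =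
      lie_deriv Y (cartan_deriv (\<lambda>Zs. \<omega> (Z # Zs))) Ws - cartan_deriv (\<lambda>Ws. \<omega> (lie_bracket Y Z # Ws)) Ws"
    unfolding Suc.IH[OF inner[OF Z] Ws, symmetric]
    by (intro cartan_deriv_diff[where p = p] smooth_valued_lie_deriv[OF Y] alt_form_imp_smooth_valued inner
        Z YZ Ws)
  have 2: "lie_deriv Y (\<lambda>Ws. lie_deriv Z \<omega> Ws - cartan_deriv (\<lambda>Zs. \<omega> (Z # Zs)) Ws) Ws =
      lie_deriv Y (lie_deriv Z \<omega>) Ws - lie_deriv Y (cartan_deriv (\<lambda>Zs. \<omega> (Z # Zs))) Ws"
    by (intro lie_deriv_diff[OF M Y, where p = "Suc p"] smooth_valued_lie_deriv[OF Z] Suc.prems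
        smooth_valued_cartan_deriv[OF Suc.prems(1) Z] Ws)
  have 3: "lie_deriv Z (lie_deriv Y \<omega>) Ws =
      lie_deriv Y (lie_deriv Z \<omega>) Ws - lie_deriv (lie_bracket Y Z) \<omega> Ws"
    unfolding lie_deriv_commutator[OF M Y Z Suc.prems(1) Ws, symmetric] by (simp add: algebra_simps)
  show ?case
    unfolding Zs cartan_deriv.simps lie_deriv.simps 1 2 3 by (simp add: algebra_simps)
qed

text \<open>Contraction with \<open>Y\<close> gives \<open>L_Y d - d L_Y + d d i_Y\<close>: the
  first two terms cancel and the last vanishes by induction. On functions the claim is the
  definition of the bracket.\<close>

lemma cartan_deriv_cartan_deriv:
  assumes "alt_form M p \<omega>" "Zs \<in> lists (vector_fields M)" "length Zs = Suc (Suc p)"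
  shows "cartan_deriv (cartan_deriv \<omega>) Zs = 0"
  using assms
proof (induction p arbitrary: \<omega> Zs)
  case 0
  then obtain Y Z where Zs: "Zs = [Y, Z]" and Y: "Y \<in> vector_fields M" and Z: "Z \<in> vector_fields M"
    by (cases Zs; cases "tl Zs") auto
  show ?case
    unfolding Zs by (simp add: lie_bracket_def vector_field_0[OF M Z])
next
  case (Suc p)
  then obtain Y Ws where Zs: "Zs = Y # Ws" and Y: "Y \<in> vector_fields M"
    and Ws: "Ws \<in> lists (vector_fields M)" "length Ws = Suc (Suc p)"
    by (cases Zs) auto
  have "cartan_deriv (\<lambda>Ws. lie_deriv Y \<omega> Ws - cartan_deriv (\<lambda>Zs. \<omega> (Y # Zs)) Ws) Ws =
    cartan_deriv (lie_deriv Y \<omega>) Ws - cartan_deriv (cartan_deriv (\<lambda>Zs. \<omega> (Y # Zs))) Ws"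
    by (intro cartan_deriv_diff[where p = "Suc p"] smooth_valued_lie_deriv[OF Y] Suc.prems
        smooth_valued_cartan_deriv[OF Suc.prems(1) Y] Ws)
  also have "\<dots> = lie_deriv Y (cartan_deriv \<omega>) Ws"
    unfolding cartan_deriv_lie_deriv[OF Y Suc.prems(1) Ws]
      Suc.IH[OF alt_form_inner[OF Suc.prems(1) Y] Ws] by simp
  finally show ?case
    unfolding Zs cartan_deriv.simps by simp
qed

end

section \<open>Agreement of the recursions with \<open>forms\<close> and
  \<open>ext_deriv\<close>\<close>

lemma omit_0: "omit 0 (x # xs) = xs"
  and omit_Suc: "omit (Suc i) (x # xs) = x # omit i xs"
  by (simp_all add: omit_def)

lemma length_omit: "i < length xs \<Longrightarrow> length (omit i xs) = length xs - 1"
  by (simp add: omit_def)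

lemma omit_in_lists: "xs \<in> lists A \<Longrightarrow> omit i xs \<in> lists A"
  by (auto simp: omit_def dest: in_set_takeD in_set_dropD)

lemma nth_in_lists: "\<lbrakk>xs \<in> lists A; i < length xs\<rbrakk> \<Longrightarrow> xs ! i \<in> A"
  by auto

context
  fixes M :: "'x manifold"
  assumes M: "smooth_manifold M"
begin

lemma alt_form_cong:
  assumes "alt_form M p \<omega>"
    and "\<And>Zs. Zs \<in> lists (vector_fields M) \<Longrightarrow> length Zs = p \<Longrightarrow> \<eta> Zs = \<omega> Zs"
  shows "alt_form M p \<eta>"
  using assms
proof (induction p arbitrary: \<omega> \<eta>)
  case (Suc p)
  have eq: "\<eta> (V # Zs) = \<omega> (V # Zs)"
    if "V \<in> vector_fields M" "Zs \<in> lists (vector_fields M)" "length Zs = p" for V Zs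
    using Suc.prems(2) that by simp
  show ?case
    unfolding alt_form.simps(2)
  proof (intro conjI ballI impI)
    fix V assume V: "V \<in> vector_fields M"
    show "alt_form M p (\<lambda>Zs. \<eta> (V # Zs))"
      by (rule Suc.IH[OF alt_form_inner[OF M Suc.prems(1) V]]) (rule eq[OF V])
  next
    fix f V W Zs
    assume *: "f \<in> smooth_functions M" "V \<in> vector_fields M" "W \<in> vector_fields M"
      "Zs \<in> lists (vector_fields M)" "length Zs = p"
    then show "\<eta> (((\<lambda>h. f * V h) + W) # Zs) = f * \<eta> (V # Zs) + \<eta> (W # Zs)"
      using Suc.prems(1) eq vector_fields_module[OF M *(1-3)] by simp
  next
    fix V Zs
    assume "V \<in> vector_fields M" "Zs \<in> lists (vector_fields M)" "Suc (length Zs) = p"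
    then show "\<eta> (V # V # Zs) = 0"
      using Suc.prems(1) eq[of V "V # Zs"] by simp
  qed
qed simp

text \<open>Contracting with the fields in \<open>Ys\<close> one after the other brings the slot in
  question to the front, where the recursive definition gives linearity.\<close>

lemma alt_form_multilinear:
  assumes "alt_form M p \<omega>" "Ys \<in> lists (vector_fields M)" "Zs \<in> lists (vector_fields M)"
    and "length Ys + length Zs + 1 = p"
    and f: "f \<in> smooth_functions M" and V: "V \<in> vector_fields M" and W: "W \<in> vector_fields M"
  shows "\<omega> (Ys @ ((\<lambda>h. f * V h) + W) # Zs) = f * \<omega> (Ys @ V # Zs) + \<omega> (Ys @ W # Zs)"
  using assms(1-4)
proof (induction Ys arbitrary: p \<omega>)
  case Nil
  then have "alt_form M (Suc (length Zs)) \<omega>"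
    by simp
  then show ?case
    using f V W Nil.prems(3) unfolding alt_form.simps append.simps by blast
next
  case (Cons Y Ys)
  then obtain k where p: "p = Suc k" "length Ys + length Zs + 1 = k"
    by (cases p) auto
  then have "alt_form M k (\<lambda>Zs. \<omega> (Y # Zs))"
    using Cons.prems by simp
  from Cons.IH[OF this] show ?case
    using Cons.prems p by simp
qed

lemma alt_form_move_front:
  assumes "alt_form M p \<omega>" "Zs \<in> lists (vector_fields M)" "V \<in> vector_fields M"
    and "Ws \<in> lists (vector_fields M)" "length Zs + length Ws + 1 = p"
  shows "\<omega> (Zs @ V # Ws) = (- 1) ^ length Zs *\<^sub>R \<omega> (V # Zs @ Ws)"
  using assms
proof (induction Zs arbitrary: p \<omega>)
  case (Cons Z Zs)
  then obtain k where p: "p = Suc k" "length Zs + length Ws + 1 = k"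
    by (cases p) auto
  have inner: "alt_form M k (\<lambda>Zs. \<omega> (Z # Zs))"
    using Cons.prems p by simp
  have "\<omega> (Z # V # Zs @ Ws) = - \<omega> (V # Z # Zs @ Ws)"
    by (rule alt_form_skew[OF M, of k]) (use Cons.prems p in auto)
  moreover have "\<omega> (Z # Zs @ V # Ws) = (- 1) ^ length Zs *\<^sub>R \<omega> (Z # V # Zs @ Ws)"
    using Cons.IH[OF inner] Cons.prems p by simp
  ultimately show ?case
    by (simp only: append_Cons list.size power_add scaleR_minus_right) simp
qed simp

text \<open>Contract away \<open>Ys\<close>, then move the second \<open>V\<close> up to the first
  one at the cost of a sign; equal adjacent arguments give 0.\<close>

lemma alt_form_alternating:
  assumes "alt_form M p \<omega>" "Ys @ V # Zs @ V # Ws \<in> lists (vector_fields M)"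
    and "length (Ys @ V # Zs @ V # Ws) = p"
  shows "\<omega> (Ys @ V # Zs @ V # Ws) = 0"
  using assms
proof (induction Ys arbitrary: p \<omega>)
  case Nil
  then obtain k where p: "p = Suc (Suc k)" "length Zs + length Ws = k"
    by (cases p; cases "p - 1") auto
  have V: "V \<in> vector_fields M" and lists: "Zs \<in> lists (vector_fields M)" "Ws \<in> lists (vector_fields M)"
    using Nil by auto
  have "\<omega> (V # V # Zs @ Ws) = 0"
    using Nil.prems(1) V lists p by simp
  moreover have "alt_form M (Suc k) (\<lambda>Zs. \<omega> (V # Zs))"
    using Nil.prems(1) V p by simp
  from alt_form_move_front[OF this lists(1) V lists(2)]
  have "\<omega> (V # Zs @ V # Ws) = (- 1) ^ length Zs *\<^sub>R \<omega> (V # V # Zs @ Ws)"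
    using p by simp
  ultimately show ?case
    by simp
next
  case (Cons Y Ys)
  then obtain k where p: "p = Suc k" "length (Ys @ V # Zs @ V # Ws) = k"
    by (cases p) auto
  have "alt_form M k (\<lambda>Zs. \<omega> (Y # Zs))"
    using Cons.prems p by simp
  from Cons.IH[OF this] show ?case
    using Cons.prems p by simp
qed

lemma alt_formI:
  assumes "\<And>Ys. \<lbrakk>Ys \<in> lists (vector_fields M); length Ys = p\<rbrakk> \<Longrightarrow> \<omega> Ys \<in> smooth_functions M"
    and "\<And>Ys Zs f V W. \<lbrakk>Ys \<in> lists (vector_fields M); Zs \<in> lists (vector_fields M);
      length Ys + length Zs + 1 = p; f \<in> smooth_functions M; V \<in> vector_fields M; W \<in> vector_fields M\<rbrakk>
      \<Longrightarrow> \<omega> (Ys @ ((\<lambda>h. f * V h) + W) # Zs) = f * \<omega> (Ys @ V # Zs) + \<omega> (Ys @ W # Zs)"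
    and "\<And>Ys V Zs Ws. \<omega> (Ys @ V # Zs @ V # Ws) = 0"
  shows "alt_form M p \<omega>"
  using assms
proof (induction p arbitrary: \<omega>)
  case (Suc p)
  have "alt_form M p (\<lambda>Zs. \<omega> (V # Zs))" if "V \<in> vector_fields M" for V
  proof (rule Suc.IH)
    show "\<omega> (V # Ys @ X # Zs @ X # Ws) = 0" for Ys X Zs Ws
      using Suc.prems(3)[of "V # Ys"] by (simp only: append_Cons)
    show "\<omega> (V # Ys @ ((\<lambda>h. f * X h) + W) # Zs) = f * \<omega> (V # Ys @ X # Zs) + \<omega> (V # Ys @ W # Zs)"
      if "Ys \<in> lists (vector_fields M)" "Zs \<in> lists (vector_fields M)" "length Ys + length Zs + 1 = p"
        "f \<in> smooth_functions M" "X \<in> vector_fields M" "W \<in> vector_fields M" for Ys Zs f X W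
    proof -
      have "V # Ys \<in> lists (vector_fields M)" "length (V # Ys) + length Zs + 1 = Suc p"
        using that \<open>V \<in> vector_fields M\<close> by simp_all
      from Suc.prems(2)[OF this(1) that(2) this(2) that(4-6)] show ?thesis
        by (simp only: append_Cons)
    qed
  qed (use Suc.prems(1) that in auto)
  moreover have "\<omega> (((\<lambda>h. f * V h) + W) # Zs) = f * \<omega> (V # Zs) + \<omega> (W # Zs)"
    if "f \<in> smooth_functions M" "V \<in> vector_fields M" "W \<in> vector_fields M"
      "Zs \<in> lists (vector_fields M)" "length Zs = p" for f V W Zs
    using Suc.prems(2)[OF lists.Nil that(4) _ that(1-3)] that(5)
    by (simp only: append_Nil list.size add_0 Suc_eq_plus1)
  moreover have "\<omega> (V # V # Zs) = 0" for V Zs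
    using Suc.prems(3)[of "[]" V "[]"] by (simp only: append_Nil)
  ultimately show ?case
    unfolding alt_form.simps by blast
qed simp

lemma forms_iff_alt_form:
  "\<omega> \<in> forms M p \<longleftrightarrow> alt_form M p \<omega> \<and>
    (\<forall>Ys. \<not> (Ys \<in> lists (vector_fields M) \<and> length Ys = p) \<longrightarrow> \<omega> Ys = 0)"
proof
  assume "\<omega> \<in> forms M p"
  then show "alt_form M p \<omega> \<and>
    (\<forall>Ys. \<not> (Ys \<in> lists (vector_fields M) \<and> length Ys = p) \<longrightarrow> \<omega> Ys = 0)"
    unfolding forms_def by (intro conjI alt_formI) blast+
next
  assume *: "alt_form M p \<omega> \<and>
    (\<forall>Ys. \<not> (Ys \<in> lists (vector_fields M) \<and> length Ys = p) \<longrightarrow> \<omega> Ys = 0)"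
  \<comment> \<open>\<open>forms\<close> asks for this on all lists; those that are not
    \<open>p\<close>-tuples of vector fields are covered by the support condition.\<close>
  have "\<omega> (Ys @ V # Zs @ V # Ws) = 0" for Ys V Zs Ws
    using * alt_form_alternating by blast
  moreover have "\<omega> Ys \<in> smooth_functions M" if "Ys \<in> lists (vector_fields M)" "length Ys = p" for Ys
    using alt_form_value * that by blast
  moreover have "\<omega> (Ys @ ((\<lambda>h. f * V h) + W) # Zs) = f * \<omega> (Ys @ V # Zs) + \<omega> (Ys @ W # Zs)"
    if "Ys \<in> lists (vector_fields M)" "Zs \<in> lists (vector_fields M)" "length Ys + length Zs + 1 = p"
      "f \<in> smooth_functions M" "V \<in> vector_fields M" "W \<in> vector_fields M" for Ys Zs f V W
    using alt_form_multilinear * that by blast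
  ultimately show "\<omega> \<in> forms M p"
    unfolding forms_def using * by blast
qed

text \<open>Each step of the recursion leaves one more field in front of the bracket; moving the
  bracket past it to the front produces the alternating sign.\<close>

lemma lie_deriv_eq_sum:
  assumes Y: "Y \<in> vector_fields M" and "alt_form M p \<omega>" "Zs \<in> lists (vector_fields M)" "length Zs = p"
  shows "lie_deriv Y \<omega> Zs =
    Y (\<omega> Zs) - (\<Sum>k<p. (- 1) ^ k *\<^sub>R \<omega> (lie_bracket Y (Zs ! k) # omit k Zs))"
  using assms(2-)
proof (induction Zs arbitrary: \<omega> p)
  case (Cons Z Zs)
  let ?n = "length Zs"
  have Z: "Z \<in> vector_fields M" and Zs: "Zs \<in> lists (vector_fields M)" and p: "p = Suc ?n"
    using Cons.prems by auto
  have "\<omega> (Z # lie_bracket Y (Zs ! k) # omit k Zs) = - \<omega> (lie_bracket Y (Zs ! k) # Z # omit k Zs)"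
    if "k < ?n" for k
    by (rule alt_form_skew[OF M Cons.prems(1)[unfolded p] Z])
      (use Y Zs that in \<open>auto simp: length_omit simp del: in_lists_conv_set
        intro!: vector_fields_lie_bracket[OF M] omit_in_lists nth_in_lists\<close>)
  then have "(\<Sum>k<?n. (- 1) ^ k *\<^sub>R \<omega> (Z # lie_bracket Y (Zs ! k) # omit k Zs)) =
    (\<Sum>k<?n. (- 1) ^ Suc k *\<^sub>R \<omega> (lie_bracket Y (Zs ! k) # Z # omit k Zs))"
    by (intro sum.cong) simp_all
  moreover have "(\<Sum>k<p. (- 1) ^ k *\<^sub>R \<omega> (lie_bracket Y ((Z # Zs) ! k) # omit k (Z # Zs))) =
    \<omega> (lie_bracket Y Z # Zs) +
    (\<Sum>k<?n. (- 1) ^ Suc k *\<^sub>R \<omega> (lie_bracket Y (Zs ! k) # Z # omit k Zs))"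
    unfolding p sum.lessThan_Suc_shift by (simp add: omit_0 omit_Suc)
  moreover have "lie_deriv Y (\<lambda>Zs. \<omega> (Z # Zs)) Zs = Y (\<omega> (Z # Zs)) -
    (\<Sum>k<?n. (- 1) ^ k *\<^sub>R \<omega> (Z # lie_bracket Y (Zs ! k) # omit k Zs))"
    using Cons.IH[OF alt_form_inner[OF M Cons.prems(1)[unfolded p] Z] Zs refl] .
  ultimately show ?case
    unfolding lie_deriv.simps by (simp only: diff_diff_eq add.commute)
qed simp

text \<open>The terms in which the first field \<open>Y\<close> differentiates or enters a bracket
  are those with \<open>i = 0\<close>; they add up to \<open>lie_deriv Y \<omega> Zs\<close>. The
  rest is the same formula for the contraction with \<open>Y\<close>, negated: by the index shift in
  the first sum, by moving \<open>Y\<close> past the bracket in the second.\<close>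

lemma ext_deriv_sum_eq_cartan_deriv:
  assumes "alt_form M p \<omega>" "Ys \<in> lists (vector_fields M)" "length Ys = Suc p"
  shows "(\<Sum>i\<le>p. (- 1) ^ i *\<^sub>R (Ys ! i) (\<omega> (omit i Ys))) +
    (\<Sum>j\<le>p. \<Sum>i<j. (- 1) ^ (i + j) *\<^sub>R
      \<omega> (lie_bracket (Ys ! i) (Ys ! j) # omit i (omit j Ys))) = cartan_deriv \<omega> Ys"
  using assms
proof (induction p arbitrary: \<omega> Ys)
  case 0
  then obtain Y where "Ys = [Y]"
    by (cases Ys) auto
  then show ?case
    by (simp add: omit_0)
next
  case (Suc p)
  then obtain Y Zs where Ys: "Ys = Y # Zs" and Y: "Y \<in> vector_fields M"
    and Zs: "Zs \<in> lists (vector_fields M)" "length Zs = Suc p"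
    by (cases Ys) auto
  let ?\<eta> = "\<lambda>Zs. \<omega> (Y # Zs)"
  let ?A = "\<Sum>i\<le>p. (- 1) ^ i *\<^sub>R (Zs ! i) (?\<eta> (omit i Zs))"
  let ?B = "\<Sum>j\<le>p. \<Sum>i<j. (- 1) ^ (i + j) *\<^sub>R
      ?\<eta> (lie_bracket (Zs ! i) (Zs ! j) # omit i (omit j Zs))"
  let ?C = "\<Sum>k<Suc p. (- 1) ^ k *\<^sub>R \<omega> (lie_bracket Y (Zs ! k) # omit k Zs)"
  have A: "(\<Sum>i\<le>Suc p. (- 1) ^ i *\<^sub>R (Ys ! i) (\<omega> (omit i Ys))) = Y (\<omega> Zs) - ?A"
    unfolding sum.atMost_Suc_shift Ys by (simp add: omit_0 omit_Suc sum_negf)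
  have skew: "\<omega> (lie_bracket (Zs ! i) (Zs ! j) # Y # omit i (omit j Zs)) =
      - ?\<eta> (lie_bracket (Zs ! i) (Zs ! j) # omit i (omit j Zs))" if "j \<le> p" "i < j" for i j
    by (rule alt_form_skew[OF M Suc.prems(1) _ Y])
      (use Zs that in \<open>auto simp: length_omit simp del: in_lists_conv_set
        intro!: vector_fields_lie_bracket[OF M] omit_in_lists nth_in_lists\<close>)
  have "(\<Sum>j\<le>Suc p. \<Sum>i<j. (- 1) ^ (i + j) *\<^sub>R
      \<omega> (lie_bracket (Ys ! i) (Ys ! j) # omit i (omit j Ys))) =
    (\<Sum>j\<le>p. - ((- 1) ^ j *\<^sub>R \<omega> (lie_bracket Y (Zs ! j) # omit j Zs)) +
      (\<Sum>i<j. (- 1) ^ (i + j) *\<^sub>R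
        \<omega> (lie_bracket (Zs ! i) (Zs ! j) # Y # omit i (omit j Zs))))"
    unfolding sum.atMost_Suc_shift sum.lessThan_Suc_shift Ys by (simp add: omit_0 omit_Suc)
  also have "\<dots> = (\<Sum>j\<le>p. - ((- 1) ^ j *\<^sub>R \<omega> (lie_bracket Y (Zs ! j) # omit j Zs)) -
      (\<Sum>i<j. (- 1) ^ (i + j) *\<^sub>R
        ?\<eta> (lie_bracket (Zs ! i) (Zs ! j) # omit i (omit j Zs))))"
    by (rule sum.cong[OF refl]) (simp add: skew sum_negf)
  also have "\<dots> = - ?C - ?B"
    by (simp add: sum_subtractf sum_negf lessThan_Suc_atMost)
  finally have B: "(\<Sum>j\<le>Suc p. \<Sum>i<j. (- 1) ^ (i + j) *\<^sub>R
      \<omega> (lie_bracket (Ys ! i) (Ys ! j) # omit i (omit j Ys))) = - ?C - ?B" .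
  have "cartan_deriv \<omega> Ys = (Y (\<omega> Zs) - ?C) - (?A + ?B)"
    unfolding Ys cartan_deriv.simps lie_deriv_eq_sum[OF Y Suc.prems(1) Zs]
      Suc.IH[OF alt_form_inner[OF M Suc.prems(1) Y] Zs] ..
  then show ?case
    unfolding A B by (simp only: diff_add_eq_diff_diff_swap diff_conv_add_uminus minus_add_distrib minus_minus add_ac)
qed

lemma ext_deriv_eq_cartan_deriv:
  assumes "\<omega> \<in> forms M p"
  shows "ext_deriv M p \<omega> Ys =
    (if Ys \<in> lists (vector_fields M) \<and> length Ys = Suc p then cartan_deriv \<omega> Ys else 0)"
  using ext_deriv_sum_eq_cartan_deriv assms unfolding ext_deriv_def forms_iff_alt_form by simp

lemma ext_deriv_in_forms:
  assumes "\<omega> \<in> forms M p"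
  shows "ext_deriv M p \<omega> \<in> forms M (Suc p)"
proof -
  have "alt_form M (Suc p) (ext_deriv M p \<omega>)"
  proof (rule alt_form_cong)
    show "alt_form M (Suc p) (cartan_deriv \<omega>)"
      using assms alt_form_cartan_deriv[OF M] unfolding forms_iff_alt_form by blast
  qed (simp add: ext_deriv_eq_cartan_deriv[OF assms] del: in_lists_conv_set)
  then show ?thesis
    unfolding forms_iff_alt_form by (simp add: ext_deriv_def)
qed

theorem ext_deriv_ext_deriv:
  assumes "\<omega> \<in> forms M p"
  shows "ext_deriv M (Suc p) (ext_deriv M p \<omega>) = 0"
proof
  fix Ys
  show "ext_deriv M (Suc p) (ext_deriv M p \<omega>) Ys = 0 Ys"
  proof (cases "Ys \<in> lists (vector_fields M) \<and> length Ys = Suc (Suc p)")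
    case True
    have "ext_deriv M (Suc p) (ext_deriv M p \<omega>) Ys = cartan_deriv (ext_deriv M p \<omega>) Ys"
      unfolding ext_deriv_eq_cartan_deriv[OF ext_deriv_in_forms[OF assms]] by (rule if_P[OF True])
    \<comment> \<open>The two inner derivatives agree only on \<open>p + 1\<close> vector fields,
      hence a congruence instead of rewriting.\<close>
    also have "\<dots> = cartan_deriv (cartan_deriv \<omega>) Ys"
      by (rule cartan_deriv_cong[OF M, where p = "Suc p"])
        (use True in \<open>simp_all add: ext_deriv_eq_cartan_deriv[OF assms]\<close>)
    also have "\<dots> = 0"
      using cartan_deriv_cartan_deriv[OF M] assms True unfolding forms_iff_alt_form by blast
    finally show ?thesis
      by simp
  next
    case False
    then show ?thesis
      by (simp only: ext_deriv_def if_False zero_fun_apply)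
  qed
qed

lemma forms_value:
  "\<lbrakk>\<omega> \<in> forms M p; Ys \<in> lists (vector_fields M); length Ys = p\<rbrakk> \<Longrightarrow> \<omega> Ys \<in> smooth_functions M"
  using alt_form_value unfolding forms_iff_alt_form by blast

lemma linear_map_on_ext_deriv: "linear_map_on (forms M p) (forms M (Suc p)) (ext_deriv M p)"
proof -
  have val: "Y \<in> vector_fields M" "a (omit i Ys) \<in> smooth_functions M"
    if "Ys \<in> lists (vector_fields M) \<and> length Ys = Suc p" "i \<le> p" "a \<in> forms M p" "Y = Ys ! i" for a i Y Ys
    using that by (auto simp: length_omit simp del: in_lists_conv_set
        intro!: forms_value[of a p] omit_in_lists nth_in_lists)
  \<comment> \<open>Evaluates the sum on a list of fields only. The values remain functions, on
    which vector fields can act.\<close>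
  have plus: "(g + h) Zs = g Zs + h Zs" for g h :: "'x diff_form" and Zs
    by simp
  have "ext_deriv M p (a + b) = ext_deriv M p a + ext_deriv M p b"
    if ab: "a \<in> forms M p" "b \<in> forms M p" for a b
  proof
    fix Ys
    have *: "(Ys ! i) (a (omit i Ys) + b (omit i Ys)) = (Ys ! i) (a (omit i Ys)) + (Ys ! i) (b (omit i Ys))"
      if "Ys \<in> lists (vector_fields M) \<and> length Ys = Suc p" "i \<le> p" for i
      using val[OF that ab(1) refl] val[OF that ab(2) refl] by (intro vector_field_add[OF M])
    show "ext_deriv M p (a + b) Ys = (ext_deriv M p a + ext_deriv M p b) Ys"
    proof (cases "Ys \<in> lists (vector_fields M) \<and> length Ys = Suc p")
      case True
      have "(\<Sum>i\<le>p. (- 1) ^ i *\<^sub>R (Ys ! i) (a (omit i Ys) + b (omit i Ys))) =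
        (\<Sum>i\<le>p. (- 1) ^ i *\<^sub>R (Ys ! i) (a (omit i Ys))) + (\<Sum>i\<le>p. (- 1) ^ i *\<^sub>R (Ys ! i) (b (omit i Ys)))"
        unfolding sum.distrib[symmetric] scaleR_add_right[symmetric]
        by (rule sum.cong[OF refl]) (simp only: * True atMost_iff)
      then show ?thesis
        using True unfolding ext_deriv_def plus
        by (simp only: if_True scaleR_add_right sum.distrib add_ac simp_thms)
    qed (simp only: ext_deriv_def if_False plus add_0_left)
  qed
  moreover have "ext_deriv M p (c *\<^sub>R a) = c *\<^sub>R ext_deriv M p a" if a: "a \<in> forms M p" for a c
  proof
    fix Ys
    have *: "(Ys ! i) (c *\<^sub>R a (omit i Ys)) = c *\<^sub>R (Ys ! i) (a (omit i Ys))"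
      if "Ys \<in> lists (vector_fields M) \<and> length Ys = Suc p" "i \<le> p" for i
      using val[OF that a refl] by (intro vector_field_scaleR[OF M])
    have sc: "(c *\<^sub>R g) x = c *\<^sub>R g x" for g :: "'x vector_field list \<Rightarrow> 'x \<Rightarrow> real" and x
      by (simp add: scaleR_fun_def)
    show "ext_deriv M p (c *\<^sub>R a) Ys = (c *\<^sub>R ext_deriv M p a) Ys"
    proof (cases "Ys \<in> lists (vector_fields M) \<and> length Ys = Suc p")
      case True
      have "(\<Sum>i\<le>p. (- 1) ^ i *\<^sub>R (Ys ! i) (c *\<^sub>R a (omit i Ys))) =
        c *\<^sub>R (\<Sum>i\<le>p. (- 1) ^ i *\<^sub>R (Ys ! i) (a (omit i Ys)))"
        unfolding scaleR_sum_right scaleR_left_commute[of c]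
        by (rule sum.cong[OF refl]) (simp only: * True atMost_iff)
      then show ?thesis
        using True unfolding ext_deriv_def sc
        by (simp only: if_True scaleR_add_right scaleR_sum_right scaleR_left_commute[of c] simp_thms)
    qed (simp only: ext_deriv_def if_False sc scaleR_zero_right)
  qed
  ultimately show ?thesis
    unfolding linear_map_on_def using ext_deriv_in_forms by blast
qed

end

section \<open>Tensor products of linear maps\<close>

lemma linear_map_onD:
  assumes "linear_map_on V W f"
  shows "a \<in> V \<Longrightarrow> f a \<in> W" and "\<lbrakk>a \<in> V; b \<in> V\<rbrakk> \<Longrightarrow> f (a + b) = f a + f b"
    and "a \<in> V \<Longrightarrow> f (c *\<^sub>R a) = c *\<^sub>R f a"
  using assms by (auto simp: linear_map_on_def)

lemma linear_map_onI:
  assumes "\<And>a. a \<in> V \<Longrightarrow> f a \<in> W" and "\<And>a b. \<lbrakk>a \<in> V; b \<in> V\<rbrakk> \<Longrightarrow> f (a + b) = f a + f b"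
    and "\<And>c a. a \<in> V \<Longrightarrow> f (c *\<^sub>R a) = c *\<^sub>R f a"
  shows "linear_map_on V W f"
  using assms by (auto simp: linear_map_on_def)

lemma linear_map_on_id: "linear_map_on V V id"
  by (rule linear_map_onI) simp_all

lemma bilinear_form_on_iff:
  "bilinear_form_on V W \<beta> \<longleftrightarrow>
    (\<forall>w\<in>W. \<forall>a\<in>V. (\<forall>b\<in>V. \<beta> (a + b) w = \<beta> a w + \<beta> b w) \<and> (\<forall>c. \<beta> (c *\<^sub>R a) w = c * \<beta> a w)) \<and>
    (\<forall>v\<in>V. \<forall>a\<in>W. (\<forall>b\<in>W. \<beta> v (a + b) = \<beta> v a + \<beta> v b) \<and> (\<forall>c. \<beta> v (c *\<^sub>R a) = c * \<beta> v a))"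
  unfolding bilinear_form_on_def linear_map_on_def by auto

lemma bilinear_form_on_compose:
  assumes "linear_map_on V V' f" "linear_map_on W W' g" "bilinear_form_on V' W' \<beta>"
  shows "bilinear_form_on V W (\<lambda>v w. \<beta> (f v) (g w))"
  using assms(3) linear_map_onD[OF assms(1)] linear_map_onD[OF assms(2)]
  unfolding bilinear_form_on_iff by simp

text \<open>\<open>T\<close> is merely evaluated at a pulled-back form, so linearity holds on the
  whole function type, for arbitrary \<open>f\<close> and \<open>g\<close>.\<close>

lemma linear_tensor_map: "linear (tensor_map V W f g)"
  by (rule linearI; rule ext) (simp_all add: tensor_map_def scaleR_fun_def)

lemmas tensor_map_add = linear_add[OF linear_tensor_map]
  and tensor_map_scaleR = linear_scale[OF linear_tensor_map]
  and tensor_map_0 = linear_0[OF linear_tensor_map]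

lemma tensor_map_pure_tensor:
  assumes "linear_map_on V V' f" "linear_map_on W W' g"
  shows "tensor_map V' W' f g (pure_tensor V W v w) = pure_tensor V' W' (f v) (g w)"
  by (rule ext) (use bilinear_form_on_compose[OF assms] in \<open>simp add: tensor_map_def pure_tensor_def\<close>)

lemma subspace_tensor_product: "subspace (tensor_product V W)"
  by (simp add: tensor_product_def)

lemma tensor_map_in_tensor_product:
  assumes f: "linear_map_on V V' f" and g: "linear_map_on W W' g" and T: "T \<in> tensor_product V W"
  shows "tensor_map V' W' f g T \<in> tensor_product V' W'"
  using T unfolding tensor_product_def
proof (rule span_induct)
  show "subspace {T. tensor_map V' W' f g T \<in> span {pure_tensor V' W' v w | v w. v \<in> V' \<and> w \<in> W'}}"
    using linear_subspace_vimage[OF linear_tensor_map subspace_span] by (simp add: vimage_def)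
  show "tensor_map V' W' f g T \<in> span {pure_tensor V' W' v w | v w. v \<in> V' \<and> w \<in> W'}"
    if "T \<in> {pure_tensor V W v w | v w. v \<in> V \<and> w \<in> W}" for T
  proof -
    from that obtain v w where T: "T = pure_tensor V W v w" "v \<in> V" "w \<in> W"
      by blast
    show ?thesis
      unfolding T(1) tensor_map_pure_tensor[OF f g]
      using linear_map_onD(1)[OF f T(2)] linear_map_onD(1)[OF g T(3)] by (intro span_base) blast
  qed
qed

lemma tensor_map_eqI:
  assumes "T \<in> tensor_product V W" "linear F" "linear G"
    and "\<And>v w. v \<in> V \<Longrightarrow> w \<in> W \<Longrightarrow> F (pure_tensor V W v w) = G (pure_tensor V W v w)"
  shows "F T = G T"
  by (rule linear_eq_on_span[OF assms(2,3) _ assms(1)[unfolded tensor_product_def]])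
    (use assms(4) in blast)

text \<open>A form that passes the outer guard is pulled back to a bilinear one, which then passes
  the inner guard; so the identity holds for every functional \<open>T\<close>.\<close>

lemma tensor_map_compose:
  assumes "linear_map_on V' V'' f'" "linear_map_on W' W'' g'"
  shows "tensor_map V'' W'' f' g' (tensor_map V' W' f g T) =
    tensor_map V'' W'' (\<lambda>v. f' (f v)) (\<lambda>w. g' (g w)) T"
  by (rule ext) (use bilinear_form_on_compose[OF assms] in \<open>simp add: tensor_map_def\<close>)

lemma pure_tensor_scaleR_right:
  assumes "v \<in> V" "w \<in> W"
  shows "pure_tensor V W v (c *\<^sub>R w) = c *\<^sub>R pure_tensor V W v w"
proof
  fix \<beta>
  have "\<beta> v (c *\<^sub>R w) = c * \<beta> v w" if "bilinear_form_on V W \<beta>"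
    using that assms unfolding bilinear_form_on_iff by blast
  then show "pure_tensor V W v (c *\<^sub>R w) \<beta> = (c *\<^sub>R pure_tensor V W v w) \<beta>"
    by (simp add: pure_tensor_def scaleR_fun_def)
qed

lemma pure_tensor_zero_left:
  assumes "0 \<in> V" "w \<in> W"
  shows "pure_tensor V W 0 w = 0"
proof -
  have "\<beta> 0 w = 0" if "bilinear_form_on V W \<beta>" for \<beta>
  proof -
    have "\<beta> (0 *\<^sub>R 0) w = 0 * \<beta> 0 w"
      using that assms unfolding bilinear_form_on_iff by blast
    then show ?thesis
      by simp
  qed
  then show ?thesis
    by (auto simp: pure_tensor_def fun_eq_iff)
qed

lemma tensor_map_zero_left:
  assumes f: "linear_map_on V V' f" and g: "linear_map_on W W' g" and T: "T \<in> tensor_product V W"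
    and 0: "\<And>v. v \<in> V \<Longrightarrow> f v = 0"
  shows "tensor_map V' W' f g T = 0"
proof (rule tensor_map_eqI[OF T linear_tensor_map linear_zero])
  fix v w assume "v \<in> V" "w \<in> W"
  \<comment> \<open>\<open>V'\<close> is just a set here; that it contains 0 is read off from a
    value of \<open>f\<close>.\<close>
  moreover from this have "0 \<in> V'"
    using linear_map_onD(1)[OF f] 0 by metis
  ultimately show "tensor_map V' W' f g (pure_tensor V W v w) = 0"
    unfolding tensor_map_pure_tensor[OF f g] 0[OF \<open>v \<in> V\<close>]
    by (intro pure_tensor_zero_left linear_map_onD(1)[OF g])
qed

text \<open>Used with \<open>c = - 1\<close> to carry the sign of \<open>\<psi>\<close> from
  sections to tensors, and with \<open>c = 0\<close> to show that a zero map on the right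
  annihilates tensors.\<close>

lemma tensor_map_scaleR_right:
  assumes f: "linear_map_on V V' f" and g: "linear_map_on W W' g" and g': "linear_map_on W W' g'"
    and eq: "\<And>w. w \<in> W \<Longrightarrow> g' w = c *\<^sub>R g w" and T: "T \<in> tensor_product V W"
  shows "tensor_map V' W' f g' T = c *\<^sub>R tensor_map V' W' f g T"
proof (rule tensor_map_eqI[OF T linear_tensor_map linear_compose_scale_right[OF linear_tensor_map]])
  show "tensor_map V' W' f g' (pure_tensor V W v w) = c *\<^sub>R tensor_map V' W' f g (pure_tensor V W v w)"
    if "v \<in> V" "w \<in> W" for v w
    unfolding tensor_map_pure_tensor[OF f g'] tensor_map_pure_tensor[OF f g] eq[OF that(2)]
    by (intro pure_tensor_scaleR_right linear_map_onD(1)[OF f] linear_map_onD(1)[OF g] that)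
qed

lemma tensor_map_zero_right:
  assumes f: "linear_map_on V V' f" and g: "linear_map_on W W' g" and T: "T \<in> tensor_product V W"
    and 0: "\<And>w. w \<in> W \<Longrightarrow> g w = 0"
  shows "tensor_map V' W' f g T = 0"
proof -
  have "tensor_map V' W' f g T = 0 *\<^sub>R tensor_map V' W' f g T"
    by (rule tensor_map_scaleR_right[OF f g g _ T]) (simp only: 0 scaleR_zero_right)
  then show ?thesis
    by (simp only: scaleR_zero_left)
qed

section \<open>The operators on sections of the symmetric powers\<close>

text \<open>Charts are homeomorphisms onto open sets, so restricting them to \<open>U\<close> keeps
  their images open; differentiation of chart expressions relies on this.\<close>

lemma openin_chart_open_submanifold:
  assumes M: "smooth_manifold M" and U: "openin (mtop M) U"
    and "(V, \<phi>) \<in> matlas (open_submanifold M U)"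
  shows "openin (Euclidean_space (mdim M)) (\<phi> ` V)"
proof -
  obtain V' where V': "V = V' \<inter> U" "(V', \<phi>) \<in> matlas M"
    using assms(3) by (auto simp: open_submanifold_def)
  then have E: "openin (Euclidean_space (mdim M)) (\<phi> ` V')"
    and hom: "homeomorphic_map (subtopology (mtop M) V')
      (subtopology (Euclidean_space (mdim M)) (\<phi> ` V')) \<phi>"
    using M unfolding smooth_manifold_def by blast+
  have "openin (subtopology (mtop M) V') V"
    unfolding V'(1) openin_subtopology using U by blast
  then have "openin (subtopology (Euclidean_space (mdim M)) (\<phi> ` V')) (\<phi> ` V)"
    using homeomorphic_imp_open_map[OF hom] unfolding open_map_def by blast
  then show ?thesis
    using openin_trans_full[OF _ E] by blast
qed

lemma smooth_functions_open_submanifold_scaleR: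
  assumes M: "smooth_manifold M" and U: "openin (mtop M) U"
    and f: "f \<in> smooth_functions (open_submanifold M U)"
  shows "c *\<^sub>R f \<in> smooth_functions (open_submanifold M U)"
proof -
  have "C_infinity_on (mdim M) (\<phi> ` V) (\<lambda>v. c * f (inv_into V \<phi> v))"
    if V: "(V, \<phi>) \<in> matlas (open_submanifold M U)" for V \<phi>
  proof -
    have "C_infinity_on (mdim M) (\<phi> ` V) (\<lambda>v. f (inv_into V \<phi> v))"
      using f V by (auto simp: smooth_functions_def open_submanifold_def)
    from C_infinity_algebra.mult[OF C_infinity_algebra.const C_infinity_algebra.base[OF this]]
    show ?thesis
      by (rule C_infinity_algebra_imp_C_infinity_on[OF openin_chart_open_submanifold[OF M U V]])
  qed
  moreover have "mdim (open_submanifold M U) = mdim M"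
    by (simp add: open_submanifold_def)
  ultimately show ?thesis
    using f by (auto simp: smooth_functions_def scaleR_fun_def)
qed

lemma sym_sections_scaleR:
  assumes M: "smooth_manifold (base P)" and s: "s \<in> sym_sections P q"
  shows "c *\<^sub>R s \<in> sym_sections P q"
proof -
  have "(\<lambda>x. if x \<in> U then (c *\<^sub>R s) x (\<lambda>vs. \<beta> (map (\<lambda>v. v (\<sigma> x)) vs)) else 0)
      \<in> smooth_functions (open_submanifold (base P) U)"
    if "local_section P U \<sigma>" "symmetric_form_on (lie_alg P) q \<beta>" for U \<sigma> \<beta>
  proof -
    let ?f = "\<lambda>x. if x \<in> U then s x (\<lambda>vs. \<beta> (map (\<lambda>v. v (\<sigma> x)) vs)) else 0"
    have "openin (mtop (base P)) U"
      using that(1) by (simp add: local_section_def)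
    moreover have "?f \<in> smooth_functions (open_submanifold (base P) U)"
      using s that unfolding sym_sections_def by blast
    ultimately have "c *\<^sub>R ?f \<in> smooth_functions (open_submanifold (base P) U)"
      by (rule smooth_functions_open_submanifold_scaleR[OF M])
    moreover have "c *\<^sub>R ?f =
        (\<lambda>x. if x \<in> U then (c *\<^sub>R s) x (\<lambda>vs. \<beta> (map (\<lambda>v. v (\<sigma> x)) vs)) else 0)"
      by (auto simp: fun_eq_iff scaleR_fun_def)
    ultimately show ?thesis
      by simp
  qed
  moreover have "(c *\<^sub>R s) x = c *\<^sub>R s x" for x
    by (simp add: scaleR_fun_def)
  moreover have "c *\<^sub>R s x \<in> Sym (ad_fibre P x) q" if "x \<in> points (base P)" for x
    using s that by (simp add: sym_sections_def Sym_def span_scale)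
  moreover have "c *\<^sub>R s x = 0" if "x \<notin> points (base P)" for x
    using s that by (simp add: sym_sections_def)
  ultimately show ?thesis
    unfolding sym_sections_def by auto
qed

lemma sym_sections_value:
  "\<lbrakk>s \<in> sym_sections P q; x \<in> points (base P)\<rbrakk> \<Longrightarrow> s x \<in> Sym (ad_fibre P x) q"
  by (simp add: sym_sections_def)

lemma scaleR_apply: "(c *\<^sub>R f) x = c *\<^sub>R f x"
  by (simp add: scaleR_fun_def)

context
  fixes P :: "('x, 'k, 'p) bundle_data" and \<iota> :: "('x, 'k, 'p) fibre_operator"
  assumes M: "smooth_manifold (base P)" and \<iota>: "square_zero_derivations P \<iota>"
begin

lemma iota_linear:
  assumes "\<psi> \<in> ad_sections P" "x \<in> points (base P)"
  shows "linear_map_on (Sym (ad_fibre P x) q) (Sym (ad_fibre P x) (Suc q)) (\<iota> \<psi> q x)"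
  using \<iota> assms unfolding square_zero_derivations_def by blast

lemma linear_map_on_on_sections:
  assumes \<psi>: "\<psi> \<in> ad_sections P"
  shows "linear_map_on (sym_sections P q) (sym_sections P (Suc q)) (on_sections P \<iota> \<psi> q)"
proof (rule linear_map_onI)
  show "on_sections P \<iota> \<psi> q s \<in> sym_sections P (Suc q)" if "s \<in> sym_sections P q" for s
    using \<iota> \<psi> that unfolding square_zero_derivations_def by blast
  show "on_sections P \<iota> \<psi> q (s + t) = on_sections P \<iota> \<psi> q s + on_sections P \<iota> \<psi> q t"
    if s: "s \<in> sym_sections P q" and t: "t \<in> sym_sections P q" for s t
  proof
    fix x
    have "\<iota> \<psi> q x (s x + t x) = \<iota> \<psi> q x (s x) + \<iota> \<psi> q x (t x)" if "x \<in> points (base P)"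
      using linear_map_onD(2)[OF iota_linear[OF \<psi> that]] sym_sections_value[OF s that]
        sym_sections_value[OF t that] .
    then show "on_sections P \<iota> \<psi> q (s + t) x = (on_sections P \<iota> \<psi> q s + on_sections P \<iota> \<psi> q t) x"
      by (simp add: on_sections_def)
  qed
  show "on_sections P \<iota> \<psi> q (c *\<^sub>R s) = c *\<^sub>R on_sections P \<iota> \<psi> q s"
    if s: "s \<in> sym_sections P q" for c s
  proof
    fix x
    have "\<iota> \<psi> q x (c *\<^sub>R s x) = c *\<^sub>R \<iota> \<psi> q x (s x)" if "x \<in> points (base P)"
      using linear_map_onD(3)[OF iota_linear[OF \<psi> that]] sym_sections_value[OF s that] .
    then show "on_sections P \<iota> \<psi> q (c *\<^sub>R s) x = (c *\<^sub>R on_sections P \<iota> \<psi> q s) x"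
      unfolding scaleR_apply[of c "on_sections P \<iota> \<psi> q s" x]
      unfolding on_sections_def scaleR_apply[of c s x]
      by (cases "x \<in> points (base P)") (simp_all only: if_True if_False scaleR_zero_right)
  qed
qed

lemma on_sections_square_zero:
  assumes \<psi>: "\<psi> \<in> ad_sections P" and s: "s \<in> sym_sections P q"
  shows "on_sections P \<iota> \<psi> (Suc q) (on_sections P \<iota> \<psi> q s) = 0"
proof
  fix x
  show "on_sections P \<iota> \<psi> (Suc q) (on_sections P \<iota> \<psi> q s) x = 0 x"
  proof (cases "x \<in> points (base P)")
    case True
    then have "\<iota> \<psi> (Suc q) x (\<iota> \<psi> q x (s x)) = 0"
      using \<iota> \<psi> sym_sections_value[OF s] unfolding square_zero_derivations_def by blast
    then show ?thesis
      using True unfolding on_sections_def by (simp only: if_True zero_fun_apply)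
  qed (simp only: on_sections_def if_False zero_fun_apply)
qed

text \<open>The condition on \<open>s\<close> is fibrewise so that it also applies to a sum of two
  sections, whose fibre values lie in the symmetric power because this is a span.\<close>

lemma on_sections_uminus:
  assumes \<psi>: "\<psi> \<in> ad_sections P"
    and s: "\<And>x. x \<in> points (base P) \<Longrightarrow> s x \<in> Sym (ad_fibre P x) q"
  shows "on_sections P \<iota> (- \<psi>) q s = (- 1) *\<^sub>R on_sections P \<iota> \<psi> q s"
proof
  fix x
  show "on_sections P \<iota> (- \<psi>) q s x = ((- 1) *\<^sub>R on_sections P \<iota> \<psi> q s) x"
  proof (cases "x \<in> points (base P)")
    case True
    then have "linear_map_on (ad_sections P) UNIV (\<lambda>\<psi>. \<iota> \<psi> q x (s x))"
      using \<iota> s unfolding square_zero_derivations_def by blast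
    \<comment> \<open>The scaling clause of \<open>linear_map_on\<close> asks for membership of
      \<open>\<psi>\<close> itself, not of its multiple.\<close>
    from linear_map_onD(3)[OF this \<psi>, of "- 1"]
    have "\<iota> (- \<psi>) q x (s x) = (- 1) *\<^sub>R \<iota> \<psi> q x (s x)"
      by (simp only: scaleR_minus_left scaleR_one)
    then show ?thesis
      using True unfolding scaleR_apply on_sections_def by (simp only: if_True)
  qed (simp only: scaleR_apply on_sections_def if_False scaleR_zero_right)
qed

text \<open>The mapping property is transported from the operator of \<open>\<psi>\<close>, of which
  this one is the negative, rather than derived from membership of \<open>- \<psi>\<close> in
  \<open>ad_sections P\<close>.\<close>

lemma linear_map_on_on_sections_uminus:
  assumes \<psi>: "\<psi> \<in> ad_sections P"
  shows "linear_map_on (sym_sections P q) (sym_sections P (Suc q)) (on_sections P \<iota> (- \<psi>) q)"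
proof -
  note lin = linear_map_onD[OF linear_map_on_on_sections[OF \<psi>]]
  have neg: "on_sections P \<iota> (- \<psi>) q s = (- 1) *\<^sub>R on_sections P \<iota> \<psi> q s" if "s \<in> sym_sections P q" for s
    by (rule on_sections_uminus[OF \<psi> sym_sections_value[OF that]])
  show ?thesis
  proof (rule linear_map_onI)
    fix s assume s: "s \<in> sym_sections P q"
    show "on_sections P \<iota> (- \<psi>) q s \<in> sym_sections P (Suc q)"
      unfolding neg[OF s] by (rule sym_sections_scaleR[OF M lin(1)[OF s]])
    show "on_sections P \<iota> (- \<psi>) q (c *\<^sub>R s) = c *\<^sub>R on_sections P \<iota> (- \<psi>) q s" for c
      unfolding neg[OF s] neg[OF sym_sections_scaleR[OF M s]] lin(3)[OF s] by (rule scaleR_left_commute)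
    fix t assume t: "t \<in> sym_sections P q"
    have "(s + t) x \<in> Sym (ad_fibre P x) q" if "x \<in> points (base P)" for x
      using sym_sections_value[OF s that] sym_sections_value[OF t that] by (simp add: Sym_def span_add)
    from on_sections_uminus[OF \<psi> this]
    show "on_sections P \<iota> (- \<psi>) q (s + t) = on_sections P \<iota> (- \<psi>) q s + on_sections P \<iota> (- \<psi>) q t"
      unfolding neg[OF s] neg[OF t] lin(2)[OF s t] by (simp only: scaleR_add_right)
  qed
qed

end

section \<open>The bigraded complex\<close>

lemma bigraded_eqI: "(\<And>p q. s p q = t p q) \<Longrightarrow> s = t" for s t :: "nat \<Rightarrow> nat \<Rightarrow> 'a"
  by (simp add: fun_eq_iff)

lemma bigraded_scaleR: "(c *\<^sub>R s) p q = c *\<^sub>R s p q" for s :: "('x, 'k, 'p) bigraded"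
  by (simp only: scaleR_fun_def)

lemma bigraded_zero: "0 p q = 0" for p q :: nat
  by simp

lemma D_total_add: "D_total P \<iota> c \<psi> (s + t) = D_total P \<iota> c \<psi> s + D_total P \<iota> c \<psi> t"
  by (rule bigraded_eqI) (simp add: D_total_def tensor_map_add scaleR_add_right split: nat.split)

lemma J_map_add: "J_map a (s + t) = J_map a s + J_map a t"
  by (rule bigraded_eqI) (simp add: J_map_def scaleR_add_right)

lemma J_map_scaleR: "J_map a (c *\<^sub>R s) = c *\<^sub>R J_map a s"
  by (rule bigraded_eqI) (simp only: J_map_def bigraded_scaleR scaleR_left_commute[of _ c])

lemma D_total_scaleR: "D_total P \<iota> c \<psi> (k *\<^sub>R s) = k *\<^sub>R D_total P \<iota> c \<psi> s"
proof (rule bigraded_eqI)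
  fix p q
  show "D_total P \<iota> c \<psi> (k *\<^sub>R s) p q = (k *\<^sub>R D_total P \<iota> c \<psi> s) p q"
    unfolding bigraded_scaleR D_total_def
    by (cases p; cases q) (simp_all only: nat.case bigraded_scaleR tensor_map_scaleR scaleR_add_right
        scaleR_zero_right scaleR_left_commute[of _ k])
qed

lemma U_map_eq_J_map: "U_map = J_map (- 1)"
  by (rule ext) (simp only: U_map_def J_map_def)

lemma J_map_J_map: "J_map a (J_map b s) = J_map (a * b) s"
  by (rule bigraded_eqI) (simp add: J_map_def power_mult_distrib)

lemma J_map_1: "J_map 1 s = s"
  by (rule bigraded_eqI) (simp add: J_map_def)

text \<open>At \<open>(p, q)\<close> the second summand comes from \<open>(p, q - 1)\<close>, so
  that splitting \<open>a ^ q\<close> into \<open>a * a ^ (q - 1)\<close> leaves the factor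
  \<open>a\<close> over; the first summand keeps \<open>q\<close>.\<close>

lemma J_map_D_total:
  assumes "a \<noteq> 0"
  shows "J_map a (D_total P \<iota> c \<psi> s) = D_total P \<iota> (a * c) \<psi> (J_map a s)"
proof (rule bigraded_eqI)
  fix p q
  show "J_map a (D_total P \<iota> c \<psi> s) p q = D_total P \<iota> (a * c) \<psi> (J_map a s) p q"
    unfolding J_map_def D_total_def
    by (cases p; cases q) (simp_all add: tensor_map_scaleR scaleR_add_right scaleR_diff_right mult_ac)
qed

lemma S_spaceI:
  assumes "\<And>p q. p + q = n \<Longrightarrow> s p q \<in> B_space P p q" "\<And>p q. p + q \<noteq> n \<Longrightarrow> s p q = 0"
  shows "s \<in> S_space P n"
  using assms by (simp add: S_space_def)

lemma subspace_B_space: "subspace (B_space P p q)"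
  unfolding B_space_def by (rule subspace_tensor_product)

text \<open>Off the diagonal \<open>p + q = n\<close> the component is 0, which also lies in
  \<open>B_space P p q\<close>; closure arguments can therefore treat all components alike.\<close>

lemma
  assumes "s \<in> S_space P n"
  shows S_space_component: "s p q \<in> B_space P p q"
    and S_space_outside: "p + q \<noteq> n \<Longrightarrow> s p q = 0"
proof -
  have *: "if p + q = n then s p q \<in> B_space P p q else s p q = 0"
    using assms unfolding S_space_def by blast
  then show "s p q \<in> B_space P p q"
    using subspace_0[OF subspace_B_space, of P p q] by (cases "p + q = n") auto
  show "p + q \<noteq> n \<Longrightarrow> s p q = 0"
    using * by simp
qed

lemma subspace_S_space: "subspace (S_space P n)"
proof (rule subspaceI)
  show "0 \<in> S_space P n"
    by (rule S_spaceI) (simp_all add: subspace_0[OF subspace_B_space])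
  show "s + t \<in> S_space P n" if "s \<in> S_space P n" "t \<in> S_space P n" for s t
    by (intro S_spaceI) (simp_all add: S_space_component[OF that(1)] S_space_component[OF that(2)]
        S_space_outside[OF that(1)] S_space_outside[OF that(2)] subspace_add[OF subspace_B_space])
  show "c *\<^sub>R s \<in> S_space P n" if "s \<in> S_space P n" for c s
    by (intro S_spaceI; unfold bigraded_scaleR) (simp_all add: S_space_component[OF that]
        S_space_outside[OF that] subspace_scale[OF subspace_B_space])
qed

lemma J_map_in_S_space:
  assumes "s \<in> S_space P n"
  shows "J_map a s \<in> S_space P n"
  unfolding J_map_def by (intro S_spaceI) (simp_all add: S_space_component[OF assms]
      S_space_outside[OF assms] subspace_scale[OF subspace_B_space])

lemma linear_map_on_J_map: "linear_map_on (S_space P n) (S_space P n) (J_map a)"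
  by (rule linear_map_onI) (rule J_map_in_S_space J_map_add J_map_scaleR; assumption?)+

lemma bij_betw_J_map:
  assumes "a \<noteq> 0"
  shows "bij_betw (J_map a) (S_space P n) (S_space P n)"
  by (rule bij_betw_byWitness[where f' = "J_map (1 / a)"])
    (use assms in \<open>auto simp: J_map_J_map J_map_1 J_map_in_S_space\<close>)

lemma graded_automorphism_J_map: "a \<noteq> 0 \<Longrightarrow> graded_automorphism (S_space P) (J_map a)"
  unfolding graded_automorphism_def using linear_map_on_J_map bij_betw_J_map by blast

lemma inv_into_J_map:
  assumes "a \<noteq> 0" "s \<in> S_space P n"
  shows "inv_into (S_space P n) (J_map a) s = J_map (1 / a) s"
  by (rule inv_into_f_eq) (use assms bij_betw_J_map[OF assms(1), of P n]
      in \<open>auto simp: bij_betw_def J_map_J_map J_map_1 J_map_in_S_space\<close>)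

lemma J_map_conjugation:
  assumes "a \<noteq> 0" "s \<in> S_space P n"
  shows "J_map a (D_total P \<iota> c \<psi> (inv_into (S_space P n) (J_map a) s)) = D_total P \<iota> (a * c) \<psi> s"
  unfolding inv_into_J_map[OF assms] J_map_D_total[OF assms(1)] J_map_J_map
  using assms(1) by (simp add: J_map_1)

text \<open>Both composites equal the identity on the complexes, so zero homotopies serve;
  compatibility of the inverse \<open>g\<close> with the differentials follows from that of
  \<open>f\<close>.\<close>

lemma chain_homotopy_equivalent_iso:
  assumes C: "cochain_complex C d" and C': "cochain_complex C' d'"
    and f: "\<And>n. linear_map_on (C n) (C' n) f" and g: "\<And>n. linear_map_on (C' n) (C n) g"
    and gf: "\<And>n a. a \<in> C n \<Longrightarrow> g (f a) = a" and fg: "\<And>n a. a \<in> C' n \<Longrightarrow> f (g a) = a"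
    and fd: "\<And>n a. a \<in> C n \<Longrightarrow> f (d a) = d' (f a)"
  shows "chain_homotopy_equivalent C d C' d'"
proof -
  have hom: "chain_homotopic K e K e (\<lambda>n. h) (\<lambda>n. id)"
    if K: "cochain_complex K e" and h: "\<And>n a. a \<in> K n \<Longrightarrow> h a = a" for K e and h :: "'c::real_vector \<Rightarrow> 'c"
  proof -
    have sub: "subspace (K n)" and lin: "linear_map_on (K n) (K (Suc n)) e" for n
      using K by (auto simp: cochain_complex_def)
    \<comment> \<open>The zero homotopy contributes \<open>e 0\<close>, which must vanish.\<close>
    have "e (0 *\<^sub>R 0) = 0 *\<^sub>R e 0"
      by (rule linear_map_onD(3)[OF lin[of 0] subspace_0[OF sub]])
    then have "e 0 = 0"
      by simp
    then show ?thesis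
      unfolding chain_homotopic_def
      by (intro exI[of _ "\<lambda>n a. 0"]) (auto simp: h linear_map_on_def subspace_0[OF sub])
  qed
  have gd: "g (d' a) = d (g a)" if a: "a \<in> C' n" for n a
  proof -
    have ga: "g a \<in> C n"
      by (rule linear_map_onD(1)[OF g a])
    have "d (g a) \<in> C (Suc n)"
      using C ga linear_map_onD(1) unfolding cochain_complex_def by blast
    from gf[OF this] show ?thesis
      unfolding fd[OF ga] fg[OF a] .
  qed
  have "chain_map C d C' d' (\<lambda>n. f)" "chain_map C' d' C d (\<lambda>n. g)"
    using f g fd gd unfolding chain_map_def by blast+
  moreover have "chain_homotopic C d C d (\<lambda>n. g \<circ> f) (\<lambda>n. id)"
    by (rule hom[OF C]) (simp add: gf)
  moreover have "chain_homotopic C' d' C' d' (\<lambda>n. f \<circ> g) (\<lambda>n. id)"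
    by (rule hom[OF C']) (simp add: fg)
  ultimately show ?thesis
    unfolding chain_homotopy_equivalent_def using C C' by blast
qed

section \<open>The total differential: square zero and the sign of the section\<close>

context
  fixes P :: "('x, 'k, 'p) bundle_data" and \<iota> :: "('x, 'k, 'p) fibre_operator" and \<psi>
  assumes M: "smooth_manifold (base P)" and \<iota>: "square_zero_derivations P \<iota>"
    and \<psi>: "\<psi> \<in> ad_sections P"
begin

lemmas d_linear = linear_map_on_ext_deriv[OF M]
  and iota_sections_linear = linear_map_on_on_sections[OF M \<iota> \<psi>]

text \<open>\<open>dR\<close> and \<open>iw\<close> carry the bidegree of their source, whereas
  \<open>D_total\<close> is written by the bidegree of the target.\<close>

abbreviation dR :: "nat \<Rightarrow> nat \<Rightarrow> (('x diff_form \<Rightarrow> ('x \<Rightarrow> ('k, 'p) adjoint_sym) \<Rightarrow> real) \<Rightarrow> real) \<Rightarrow> _" where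
  "dR p q \<equiv> tensor_map (forms (base P) (Suc p)) (sym_sections P q) (ext_deriv (base P) p) id"

abbreviation iw :: "nat \<Rightarrow> nat \<Rightarrow> (('x diff_form \<Rightarrow> ('x \<Rightarrow> ('k, 'p) adjoint_sym) \<Rightarrow> real) \<Rightarrow> real) \<Rightarrow> _" where
  "iw p q \<equiv> tensor_map (forms (base P) p) (sym_sections P (Suc q)) id (on_sections P \<iota> \<psi> q)"

lemma dR_in_B_space: "T \<in> B_space P p q \<Longrightarrow> dR p q T \<in> B_space P (Suc p) q"
  unfolding B_space_def by (rule tensor_map_in_tensor_product[OF d_linear linear_map_on_id])

lemma iw_in_B_space: "T \<in> B_space P p q \<Longrightarrow> iw p q T \<in> B_space P p (Suc q)"
  unfolding B_space_def by (rule tensor_map_in_tensor_product[OF linear_map_on_id iota_sections_linear])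

lemma linear_map_on_compose:
  assumes "linear_map_on V V' f" "linear_map_on V' V'' g"
  shows "linear_map_on V V'' (\<lambda>v. g (f v))"
  using assms unfolding linear_map_on_def by (simp add: image_subset_iff)

lemma dR_dR:
  assumes "T \<in> B_space P p q"
  shows "dR (Suc p) q (dR p q T) = 0"
  unfolding tensor_map_compose[OF d_linear linear_map_on_id]
  by (rule tensor_map_zero_left[OF linear_map_on_compose[OF d_linear d_linear] _ assms[unfolded B_space_def]])
    (simp_all add: linear_map_on_id[unfolded id_def] ext_deriv_ext_deriv[OF M])

lemma iw_iw:
  assumes "T \<in> B_space P p q"
  shows "iw p (Suc q) (iw p q T) = 0"
  unfolding tensor_map_compose[OF linear_map_on_id iota_sections_linear]
  by (rule tensor_map_zero_right[OF _ linear_map_on_compose[OF iota_sections_linear iota_sections_linear]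
        assms[unfolded B_space_def]])
    (simp_all add: linear_map_on_id[unfolded id_def] on_sections_square_zero[OF M \<iota> \<psi>])

text \<open>The operators act on different tensor factors, so both composites are the tensor product
  of \<open>ext_deriv\<close> with \<open>on_sections\<close>.\<close>

lemma dR_iw: "dR p (Suc q) (iw p q T) = iw (Suc p) q (dR p q T)"
  unfolding tensor_map_compose[OF d_linear linear_map_on_id]
    tensor_map_compose[OF linear_map_on_id iota_sections_linear] by simp

lemma D_total_eq: "D_total P \<iota> c \<psi> s p q =
    (case p of 0 \<Rightarrow> 0 | Suc p' \<Rightarrow> dR p' q (s p' q)) +
    (case q of 0 \<Rightarrow> 0 | Suc q' \<Rightarrow> ((- 1) ^ p * c) *\<^sub>R iw p q' (s p q'))"
  by (cases p; cases q) (simp_all add: D_total_def)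

lemma D_total_in_S_space:
  assumes s: "s \<in> S_space P n"
  shows "D_total P \<iota> c \<psi> s \<in> S_space P (Suc n)"
proof (rule S_spaceI)
  note comp = S_space_component[OF s] and out = S_space_outside[OF s]
  show "D_total P \<iota> c \<psi> s p q \<in> B_space P p q" for p q
    unfolding D_total_eq
  proof (rule subspace_add[OF subspace_B_space])
    show "(case p of 0 \<Rightarrow> 0 | Suc p' \<Rightarrow> dR p' q (s p' q)) \<in> B_space P p q"
      by (cases p) (simp_all only: nat.case subspace_0[OF subspace_B_space] dR_in_B_space[OF comp])
    show "(case q of 0 \<Rightarrow> 0 | Suc q' \<Rightarrow> ((- 1) ^ p * c) *\<^sub>R iw p q' (s p q')) \<in> B_space P p q"
      by (cases q) (simp_all only: nat.case subspace_0[OF subspace_B_space]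
          subspace_scale[OF subspace_B_space iw_in_B_space[OF comp]])
  qed
  show "D_total P \<iota> c \<psi> s p q = 0" if "p + q \<noteq> Suc n" for p q
  proof -
    have "(case p of 0 \<Rightarrow> 0 | Suc p' \<Rightarrow> dR p' q (s p' q)) = 0"
    proof (cases p)
      case (Suc p')
      then have "s p' q = 0"
        using that by (intro out) simp
      then show ?thesis
        by (simp only: Suc nat.case tensor_map_0)
    qed (simp only: nat.case)
    moreover have "(case q of 0 \<Rightarrow> 0 | Suc q' \<Rightarrow> ((- 1) ^ p * c) *\<^sub>R iw p q' (s p q')) = 0"
    proof (cases q)
      case (Suc q')
      then have "s p q' = 0"
        using that by (intro out) simp
      then show ?thesis
        by (simp only: Suc nat.case tensor_map_0 scaleR_zero_right)
    qed (simp only: nat.case)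
    ultimately show ?thesis
      unfolding D_total_eq by (simp only: add_0_left)
  qed
qed

text \<open>The mixed composites reaching \<open>(p, q)\<close> both start at
  \<open>(p - 1, q - 1)\<close> and agree by \<open>dR_iw\<close>, but \<open>\<iota>\<close> is
  applied in de Rham degree \<open>p - 1\<close> in one and \<open>p\<close> in the other, which
  gives opposite signs.\<close>

lemma D_total_D_total:
  assumes s: "s \<in> S_space P n"
  shows "D_total P \<iota> c \<psi> (D_total P \<iota> c \<psi> s) = 0"
proof (rule bigraded_eqI)
  fix p q
  note comp = S_space_component[OF s]
  note rules = nat.case tensor_map_add linear_diff[OF linear_tensor_map] tensor_map_scaleR tensor_map_0 dR_dR[OF comp] iw_iw[OF comp] dR_iw
    scaleR_zero_right add_0_left add_0_right
  have sign: "((- 1) ^ p * c) *\<^sub>R T + ((- 1) ^ Suc p * c) *\<^sub>R T = 0" for p and T :: "'z::real_vector"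
    by simp
  show "D_total P \<iota> c \<psi> (D_total P \<iota> c \<psi> s) p q = 0 p q"
    unfolding bigraded_zero D_total_eq
    \<comment> \<open>Each index is 0, 1 or at least 2: a mixed term needs one step in either
      direction, a squared one two steps in the same.\<close>
    by (cases p; cases "p - 1"; cases q; cases "q - 1") (simp_all add: rules sign)
qed

lemma cochain_complex_D_total: "cochain_complex (S_space P) (D_total P \<iota> c \<psi>)"
  unfolding cochain_complex_def
  using subspace_S_space D_total_in_S_space D_total_D_total D_total_add D_total_scaleR
  by (auto intro!: linear_map_onI)

text \<open>Unlike the rescaling by \<open>J_map\<close>, this is confined to
  \<open>S_space\<close>: linearity in \<open>\<psi>\<close> is known on the symmetric powers of the
  fibres, hence on sections and on the span of their pure tensors.\<close>

lemma D_total_uminus: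
  assumes s: "s \<in> S_space P n"
  shows "D_total P \<iota> (- c) \<psi> s = D_total P \<iota> c (- \<psi>) s"
proof (rule bigraded_eqI)
  fix p q
  have uminus: "on_sections P \<iota> (- \<psi>) q w = (- 1) *\<^sub>R on_sections P \<iota> \<psi> q w"
    if "w \<in> sym_sections P q" for q w
    by (rule on_sections_uminus[OF M \<iota> \<psi>]) (rule sym_sections_value[OF that])
  have neg: "tensor_map (forms (base P) p) (sym_sections P (Suc q)) id (on_sections P \<iota> (- \<psi>) q) (s p q) =
    (- 1) *\<^sub>R iw p q (s p q)" for p q
    by (rule tensor_map_scaleR_right[OF linear_map_on_id iota_sections_linear
          linear_map_on_on_sections_uminus[OF M \<iota> \<psi>] uminus
          S_space_component[OF s, unfolded B_space_def]])
  show "D_total P \<iota> (- c) \<psi> s p q = D_total P \<iota> c (- \<psi>) s p q"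
    unfolding D_total_def by (cases p; cases q) (simp_all add: neg)
qed

lemma chain_homotopy_equivalent_D_total:
  assumes "a \<noteq> 0"
  shows "chain_homotopy_equivalent (S_space P) (D_total P \<iota> c \<psi>) (S_space P) (D_total P \<iota> (a * c) \<psi>)"
  by (rule chain_homotopy_equivalent_iso[OF cochain_complex_D_total cochain_complex_D_total
        linear_map_on_J_map[where a = a] linear_map_on_J_map[where a = "1 / a"]])
    (use assms in \<open>simp_all add: J_map_J_map J_map_1 J_map_D_total\<close>)

end

text \<open>Serves for the differential of \<open>- \<psi>\<close>, which agrees with that of
  \<open>\<psi>\<close> with opposite coefficient on \<open>S_space\<close> only.\<close>

lemma cochain_complex_cong:
  assumes C: "cochain_complex C d" and eq: "\<And>n a. a \<in> C n \<Longrightarrow> d' a = d a"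
  shows "cochain_complex C d'"
  unfolding cochain_complex_def
proof (intro allI conjI ballI)
  fix n
  have sub: "subspace (C n)" and lin: "linear_map_on (C n) (C (Suc n)) d"
    using C by (auto simp: cochain_complex_def)
  show "subspace (C n)"
    by (rule sub)
  show "linear_map_on (C n) (C (Suc n)) d'"
    using linear_map_onD[OF lin] subspace_add[OF sub] subspace_scale[OF sub] eq[of _ n]
    by (intro linear_map_onI) simp_all
  show "d' (d' a) = 0" if "a \<in> C n" for a
    using C that eq[OF that] eq[OF linear_map_onD(1)[OF lin that]] by (simp add: cochain_complex_def)
qed

theorem theoremA:
  fixes P :: "('x, 'k, 'p) bundle_data"
    and \<iota> :: "('x, 'k, 'p) fibre_operator"
    and \<psi> :: "'x \<Rightarrow> ('k, 'p) adjoint_vec"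
  assumes "principal_bundle P"
    and "closed_manifold (base P)"
    and "square_zero_derivations P \<iota>"
    and "\<psi> \<in> ad_sections P"
  shows "graded_automorphism (S_space P) U_map \<and>
    (\<forall>\<alpha>>0. graded_automorphism (S_space P) (J_map \<alpha>)) \<and>
    (\<forall>lam::real. \<forall>n. \<forall>s\<in>S_space P n.
       U_map (D_total P \<iota> lam \<psi> (inv_into (S_space P n) U_map s)) = D_total P \<iota> (- lam) \<psi> s \<and>
       D_total P \<iota> (- lam) \<psi> s = D_total P \<iota> lam (- \<psi>) s) \<and>
    (\<forall>lam::real. \<forall>\<alpha>>0. \<forall>n. \<forall>s\<in>S_space P n.
       J_map \<alpha> (D_total P \<iota> lam \<psi> (inv_into (S_space P n) (J_map \<alpha>) s)) = D_total P \<iota> (\<alpha> * lam) \<psi> s) \<and>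
    (\<forall>lam>0.
       chain_homotopy_equivalent (S_space P) (D_total P \<iota> lam \<psi>) (S_space P) (D_total P \<iota> 1 \<psi>) \<and>
       chain_homotopy_equivalent (S_space P) (D_total P \<iota> lam \<psi>) (S_space P) (D_total P \<iota> 1 (- \<psi>)))"
proof -
  note \<iota> = assms(3) and \<psi> = assms(4)
  have M: "smooth_manifold (base P)"
    using assms(2) by (simp add: closed_manifold_def)
  note neg = D_total_uminus[OF M \<iota> \<psi>]
  have "chain_homotopy_equivalent (S_space P) (D_total P \<iota> lam \<psi>) (S_space P) (D_total P \<iota> 1 \<psi>)"
    if "lam > 0" for lam :: real
    using chain_homotopy_equivalent_D_total[OF M \<iota> \<psi>, of "1 / lam" lam] that by simp
  moreover have "chain_homotopy_equivalent (S_space P) (D_total P \<iota> lam \<psi>)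
      (S_space P) (D_total P \<iota> 1 (- \<psi>))" if "lam > 0" for lam :: real
  \<comment> \<open>Scaling by \<open>- 1 / lam\<close> turns the coefficient \<open>lam\<close>
    into \<open>- 1\<close>, and coefficient \<open>- 1\<close> with \<open>\<psi>\<close> is
    coefficient \<open>1\<close> with \<open>- \<psi>\<close>.\<close>
  proof (rule chain_homotopy_equivalent_iso[OF cochain_complex_D_total[OF M \<iota> \<psi>] _
        linear_map_on_J_map[where a = "- 1 / lam"] linear_map_on_J_map[where a = "- lam"]])
    show "cochain_complex (S_space P) (D_total P \<iota> 1 (- \<psi>))"
      by (rule cochain_complex_cong[OF cochain_complex_D_total[OF M \<iota> \<psi>] neg[symmetric]])
    show "J_map (- 1 / lam) (D_total P \<iota> lam \<psi> s) = D_total P \<iota> 1 (- \<psi>) (J_map (- 1 / lam) s)"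
      if "s \<in> S_space P n" for n s
      using \<open>lam > 0\<close> J_map_D_total[of "- 1 / lam" P \<iota> lam \<psi> s]
        neg[OF J_map_in_S_space[OF that], of 1 "- 1 / lam"] by simp
  qed (use that in \<open>simp_all add: J_map_J_map J_map_1\<close>)
  moreover have "graded_automorphism (S_space P) U_map"
    unfolding U_map_eq_J_map by (rule graded_automorphism_J_map) simp
  moreover have "U_map (D_total P \<iota> lam \<psi> (inv_into (S_space P n) U_map s)) = D_total P \<iota> (- lam) \<psi> s"
    if "s \<in> S_space P n" for lam n s
    unfolding U_map_eq_J_map using J_map_conjugation[of "- 1", OF _ that] by simp
  moreover have "graded_automorphism (S_space P) (J_map \<alpha>)" if "\<alpha> > 0" for \<alpha>
    using that by (intro graded_automorphism_J_map) simp
  moreover have "J_map \<alpha> (D_total P \<iota> lam \<psi> (inv_into (S_space P n) (J_map \<alpha>) s)) =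
      D_total P \<iota> (\<alpha> * lam) \<psi> s" if "\<alpha> > 0" "s \<in> S_space P n" for \<alpha> lam n s
    using that by (intro J_map_conjugation) simp_all
  ultimately show ?thesis
    using neg by blast
qed

end
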